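(* Let $k>1$, let $\gamma : [0,1] \to SO_{2k}$ be a path from $\mathbb{1}$ to $-\mathbb{1}$, let $X$ be a CW-complex and let $E \to SX$ be an oriented rank-$2k$ vector bundle over the suspension $SX$ with clutching function $g : X \to SO_{2k}$. Then $E$ is $\gamma$-turnable if and only if $\mathrm{TO}_\gamma([g]) = 0 \in [SX, SO_{2k}]$. Moreover, if $X$ is itself a suspension, then $\mathrm{TO}_\gamma : [X,SO_{2k}] \to [SX,SO_{2k}]$ is a homomorphism of abelian groups.
   Context: All vector bundles are real and Euclidean; automorphisms are fibrewise isometric and cover the identity of the base. A turning of $E$ is a continuous path of automorphisms of $E$ from $\mathbb{1}_E$ to $-\mathbb{1}_E$ ($v\mapsto -v$). Given a path $\gamma$ in $SO_{2k}$ from $\mathbb{1}$ to $-\mathbb{1}$, a turning of an oriented rank-$2k$ bundle is a $\gamma$-turning if its restriction to each fibre $E_b$, identified with $\mathbb{R}^{2k}$ by an orientation-preserving isometry, is path homotopic (rel endpoints) to $\gamma$; $E$ is $\gamma$-turnable if it has a $\gamma$-turning. $SX$ is the (unreduced) suspension, the union of two cones on $X$; points are written $[x,t]$ with $(x,t) \in X\times[0,1]$. Isomorphism classes of oriented rank-$2k$ bundles over $SX$ correspond bijectively to the set $[X,SO_{2k}]$ of (free) homotopy classes of maps via clutching functions. The sets $[X,SO_{2k}]$ and $[SX,SO_{2k}]$ are groups under pointwise multiplication, with $0$ the class of constant maps. The (adjointed) $\gamma$-turning obstruction is $$\mathrm{TO}_\gamma : [X,SO_{2k}] \to [SX,SO_{2k}],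 \quad [g] \mapsto \big[\,[x,t] \mapsto g(x)\gamma(t)g(x)^{-1}\,\big].$$ *)

theory Defs
  imports "HOL-Analysis.Analysis" "HOL-Algebra.Group"
begin

section \<open>CW-complexes\<close>

definition disk :: "nat \<Rightarrow> (nat \<Rightarrow> real) topology" where
  "disk n = subtopology (Euclidean_space n) {x. (\<Sum>i<n. (x i)\<^sup>2) \<le> 1}"

definition disk_interior :: "nat \<Rightarrow> (nat \<Rightarrow> real) set" where
  "disk_interior n = {x \<in> topspace (disk n). (\<Sum>i<n. (x i)\<^sup>2) < 1}"

definition disk_boundary :: "nat \<Rightarrow> (nat \<Rightarrow> real) set" where
  "disk_boundary n = {x \<in> topspace (disk n). (\<Sum>i<n. (x i)\<^sup>2) = 1}"

text \<open>Whitehead's definition: \<open>C\<close> is the set of open cells, \<open>d\<close> gives their dimensions and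
  \<open>\<Phi>\<close> their characteristic maps. The third conjunct of the cell condition also expresses closure
  finiteness, the last clause of the definition is the weak topology.\<close>

definition cw_structure ::
  "'a topology \<Rightarrow> 'a set set \<Rightarrow> ('a set \<Rightarrow> nat) \<Rightarrow> ('a set \<Rightarrow> (nat \<Rightarrow> real) \<Rightarrow> 'a) \<Rightarrow> bool" where
  "cw_structure X C d \<Phi> \<longleftrightarrow>
     \<Union>C = topspace X \<and> disjoint C \<and>
     (\<forall>e\<in>C. continuous_map (disk (d e)) X (\<Phi> e) \<and>
        homeomorphic_map (subtopology (disk (d e)) (disk_interior (d e))) (subtopology X e) (\<Phi> e) \<and>
        (\<exists>F. finite F \<and> F \<subseteq> {c \<in> C. d c < d e} \<and> \<Phi> e ` disk_boundary (d e) \<subseteq> \<Union>F)) \<and>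
     (\<forall>A\<subseteq>topspace X. (\<forall>e\<in>C. closedin X (A \<inter> X closure_of e)) \<longrightarrow> closedin X A)"

definition cw_complex :: "'a topology \<Rightarrow> bool" where
  "cw_complex X \<longleftrightarrow> Hausdorff_space X \<and> (\<exists>C d \<Phi>. cw_structure X C d \<Phi>)"

section \<open>The unreduced suspension\<close>

text \<open>\<open>susp_pt X x t\<close> is the point \<open>[x,t]\<close>, as an equivalence class in \<open>X \<times> [0,1]\<close>:
  the relation collapses each of \<open>X \<times> {0}\<close> and \<open>X \<times> {1}\<close> to a point.\<close>

definition susp_pt :: "'a topology \<Rightarrow> 'a \<Rightarrow> real \<Rightarrow> ('a \<times> real) set" where
  "susp_pt X x t = {y \<in> topspace X. y = x \<or> t = 0 \<or> t = 1} \<times> {t}"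

definition suspension :: "'a topology \<Rightarrow> ('a \<times> real) set topology" where
  "suspension X = topology (\<lambda>U.
     U \<subseteq> (\<lambda>(x,t). susp_pt X x t) ` (topspace X \<times> {0..1}) \<and>
     openin (prod_topology X (top_of_set {0..1}))
       {(x,t). x \<in> topspace X \<and> t \<in> {0..1} \<and> susp_pt X x t \<in> U})"

lemma openin_suspension:
  "openin (suspension X) U \<longleftrightarrow>
     U \<subseteq> (\<lambda>(x,t). susp_pt X x t) ` (topspace X \<times> {0..1}) \<and>
     openin (prod_topology X (top_of_set {0..1}))
       {(x,t). x \<in> topspace X \<and> t \<in> {0..1} \<and> susp_pt X x t \<in> U}"
proof -
  define S where "S = (\<lambda>(x,t). susp_pt X x t) ` (topspace X \<times> {0..1::real})"
  define P where "P U = {(x,t). x \<in> topspace X \<and> t \<in> {0..1} \<and> susp_pt X x t \<in> U}" for U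
  have int: "P (U \<inter> V) = P U \<inter> P V" for U V by (auto simp: P_def)
  have un: "P (\<Union>K) = \<Union>(P ` K)" for K by (auto simp: P_def)
  have "istopology (\<lambda>U. U \<subseteq> S \<and> openin (prod_topology X (top_of_set {0..1})) (P U))"
    unfolding istopology_def int un by (intro conjI allI impI openin_Int openin_Union) blast+
  then have "openin (topology (\<lambda>U. U \<subseteq> S \<and> openin (prod_topology X (top_of_set {0..1})) (P U))) U
      \<longleftrightarrow> U \<subseteq> S \<and> openin (prod_topology X (top_of_set {0..1})) (P U)"
    by (rule fun_cong[OF topology_inverse'])
  then show ?thesis
    unfolding suspension_def S_def P_def .
qed

lemma quotient_map_suspension:
  "quotient_map (prod_topology X (top_of_set {0..1})) (suspension X) (\<lambda>(x,t). susp_pt X x t)"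
proof -
  let ?S = "(\<lambda>(x,t). susp_pt X x t) ` (topspace X \<times> {0..1})"
  have pre: "{(x,t). x \<in> topspace X \<and> t \<in> {0..1} \<and> susp_pt X x t \<in> U} =
      {p \<in> topspace X \<times> {0..1}. (case p of (x,t) \<Rightarrow> susp_pt X x t) \<in> U}" for U
    by auto
  have "{p \<in> topspace X \<times> {0..1}. (case p of (x,t) \<Rightarrow> susp_pt X x t) \<in> ?S} = topspace X \<times> {0..1}"
    by blast
  then have "openin (suspension X) ?S"
    unfolding openin_suspension pre
    using openin_topspace[of "prod_topology X (top_of_set {0..1::real})"] by simp
  then have "?S \<subseteq> topspace (suspension X)"
    by (rule openin_subset)
  moreover have "topspace (suspension X) \<subseteq> ?S"
    using openin_topspace[of "suspension X"] unfolding openin_suspension by (rule conjunct1)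
  ultimately have top: "topspace (suspension X) = ?S"
    by (rule subset_antisym[rotated])
  show ?thesis
    unfolding quotient_map_def topspace_prod_topology topspace_euclidean_subtopology
      openin_suspension pre top by simp
qed

definition lower_cone :: "'a topology \<Rightarrow> ('a \<times> real) set set" where
  "lower_cone X = {susp_pt X x t | x t. x \<in> topspace X \<and> 0 \<le> t \<and> t \<le> 1/2}"

definition upper_cone :: "'a topology \<Rightarrow> ('a \<times> real) set set" where
  "upper_cone X = {susp_pt X x t | x t. x \<in> topspace X \<and> 1/2 \<le> t \<and> t \<le> 1}"

section \<open>Oriented Euclidean vector bundles\<close>

text \<open>An ordered basis of a fibre is encoded as the corresponding linear isomorphism from
  \<open>\<real>\<^sup>n\<close>; accordingly \<open>ori E b\<close> is the set of positively oriented bases of the fibre over \<open>b\<close>.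
  All operations are only relevant within one fibre.\<close>

record ('b, 'e, 'n::finite) vbundle =
  total :: "'e topology"
  proj :: "'e \<Rightarrow> 'b"
  vadd :: "'e \<Rightarrow> 'e \<Rightarrow> 'e"
  vscale :: "real \<Rightarrow> 'e \<Rightarrow> 'e"
  ip :: "'e \<Rightarrow> 'e \<Rightarrow> real"
  ori :: "'b \<Rightarrow> (real^'n \<Rightarrow> 'e) set"

definition fibre :: "('b, 'e, 'n::finite) vbundle \<Rightarrow> 'b \<Rightarrow> 'e set" where
  "fibre E b = {e \<in> topspace (total E). proj E e = b}"

definition fibre_iso :: "('b, 'e, 'n::finite) vbundle \<Rightarrow> 'b \<Rightarrow> (real^'n \<Rightarrow> 'e) \<Rightarrow> bool" where
  "fibre_iso E b f \<longleftrightarrow> bij_betw f UNIV (fibre E b) \<and>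
     (\<forall>u v. f (u + v) = vadd E (f u) (f v)) \<and> (\<forall>c v. f (c *\<^sub>R v) = vscale E c (f v))"

definition oriented_fibre_isometry ::
  "('b, 'e, 'n::finite) vbundle \<Rightarrow> 'b \<Rightarrow> (real^'n \<Rightarrow> 'e) \<Rightarrow> bool" where
  "oriented_fibre_isometry E b f \<longleftrightarrow>
     fibre_iso E b f \<and> (\<forall>u v. ip E (f u) (f v) = u \<bullet> v) \<and> f \<in> ori E b"

definition trivialization_on ::
  "'b topology \<Rightarrow> ('b, 'e, 'n::finite) vbundle \<Rightarrow> 'b set \<Rightarrow> ('b \<Rightarrow> real^'n \<Rightarrow> 'e) \<Rightarrow> bool" where
  "trivialization_on B E U \<phi> \<longleftrightarrow>
     (\<forall>b\<in>U. fibre_iso E b (\<phi> b)) \<and>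
     homeomorphic_map (prod_topology (subtopology B U) euclidean)
       (subtopology (total E) {e \<in> topspace (total E). proj E e \<in> U}) (\<lambda>(b,v). \<phi> b v)"

text \<open>The vector space axioms for the fibres are not listed separately, since the fibrewise linear
  bijections from \<open>\<real>\<^sup>n\<close> given by the local trivializations imply them.\<close>

definition vector_bundle :: "'b topology \<Rightarrow> ('b, 'e, 'n::finite) vbundle \<Rightarrow> bool" where
  "vector_bundle B E \<longleftrightarrow> continuous_map (total E) B (proj E) \<and>
     (\<forall>b\<in>topspace B. \<exists>U \<phi>. openin B U \<and> b \<in> U \<and> trivialization_on B E U \<phi>)"

definition euclidean_structure :: "'b topology \<Rightarrow> ('b, 'e, 'n::finite) vbundle \<Rightarrow> bool" where
  "euclidean_structure B E \<longleftrightarrow>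
     (\<forall>b\<in>topspace B. \<forall>x\<in>fibre E b. \<forall>y\<in>fibre E b.
        ip E x y = ip E y x \<and>
        (\<forall>z\<in>fibre E b. ip E (vadd E x y) z = ip E x z + ip E y z) \<and>
        (\<forall>c. ip E (vscale E c x) y = c * ip E x y) \<and>
        (x \<noteq> vscale E 0 x \<longrightarrow> ip E x x > 0)) \<and>
     continuous_map
       (subtopology (prod_topology (total E) (total E)) {(x,y). proj E x = proj E y})
       euclideanreal (\<lambda>(x,y). ip E x y)"

definition orientation_structure :: "'b topology \<Rightarrow> ('b, 'e, 'n::finite) vbundle \<Rightarrow> bool" where
  "orientation_structure B E \<longleftrightarrow>
     (\<forall>b\<in>topspace B. \<exists>f. fibre_iso E b f \<and>
        ori E b = {(\<lambda>v. f (A *v v)) | A :: real^'n^'n. det A > 0}) \<and>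
     (\<forall>b\<in>topspace B. \<exists>U \<phi>. openin B U \<and> b \<in> U \<and> trivialization_on B E U \<phi> \<and>
        (\<forall>u\<in>U. \<phi> u \<in> ori E u))"

definition oriented_euclidean_bundle :: "'b topology \<Rightarrow> ('b, 'e, 'n::finite) vbundle \<Rightarrow> bool" where
  "oriented_euclidean_bundle B E \<longleftrightarrow>
     vector_bundle B E \<and> euclidean_structure B E \<and> orientation_structure B E"

definition bundle_automorphism ::
  "'b topology \<Rightarrow> ('b, 'e, 'n::finite) vbundle \<Rightarrow> ('e \<Rightarrow> 'e) \<Rightarrow> bool" where
  "bundle_automorphism B E \<alpha> \<longleftrightarrow>
     homeomorphic_map (total E) (total E) \<alpha> \<and>
     (\<forall>e\<in>topspace (total E). proj E (\<alpha> e) = proj E e) \<and>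
     (\<forall>b\<in>topspace B. \<forall>x\<in>fibre E b. \<forall>y\<in>fibre E b.
        \<alpha> (vadd E x y) = vadd E (\<alpha> x) (\<alpha> y) \<and>
        (\<forall>c. \<alpha> (vscale E c x) = vscale E c (\<alpha> x)) \<and>
        ip E (\<alpha> x) (\<alpha> y) = ip E x y)"

section \<open>Turnings\<close>

definition SO :: "(real^'n^'n) set" where
  "SO = {A. rotation_matrix A}"

text \<open>Continuity of the path \<open>t \<mapsto> \<alpha> t\<close> of automorphisms means joint continuity.\<close>

definition turning ::
  "'b topology \<Rightarrow> ('b, 'e, 'n::finite) vbundle \<Rightarrow> (real \<Rightarrow> 'e \<Rightarrow> 'e) \<Rightarrow> bool" where
  "turning B E \<alpha> \<longleftrightarrow>
     (\<forall>t\<in>{0..1}. bundle_automorphism B E (\<alpha> t)) \<and>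
     continuous_map (prod_topology (top_of_set {0..1}) (total E)) (total E) (\<lambda>(t,e). \<alpha> t e) \<and>
     (\<forall>e\<in>topspace (total E). \<alpha> 0 e = e \<and> \<alpha> 1 e = vscale E (-1) e)"

definition gamma_turning ::
  "'b topology \<Rightarrow> ('b, 'e, 'n::finite) vbundle \<Rightarrow> (real \<Rightarrow> real^'n^'n) \<Rightarrow> (real \<Rightarrow> 'e \<Rightarrow> 'e) \<Rightarrow> bool" where
  "gamma_turning B E \<gamma> \<alpha> \<longleftrightarrow> turning B E \<alpha> \<and>
     (\<forall>b\<in>topspace B. \<exists>f. oriented_fibre_isometry E b f \<and>
        homotopic_paths SO (\<lambda>t. matrix (\<lambda>v. inv_into UNIV f (\<alpha> t (f v)))) \<gamma>)"

definition gamma_turnable ::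
  "'b topology \<Rightarrow> ('b, 'e, 'n::finite) vbundle \<Rightarrow> (real \<Rightarrow> real^'n^'n) \<Rightarrow> bool" where
  "gamma_turnable B E \<gamma> \<longleftrightarrow> (\<exists>\<alpha>. gamma_turning B E \<gamma> \<alpha>)"

text \<open>\<open>E\<close> is obtained by gluing trivial oriented Euclidean bundles over the two cones along
  \<open>X = X \<times> {1/2}\<close> by means of \<open>g\<close>.\<close>

definition clutching_function ::
  "'a topology \<Rightarrow> (('a \<times> real) set, 'e, 'n::finite) vbundle \<Rightarrow> ('a \<Rightarrow> real^'n^'n) \<Rightarrow> bool" where
  "clutching_function X E g \<longleftrightarrow> continuous_map X (top_of_set SO) g \<and>
     (\<exists>\<phi> \<psi>.
        trivialization_on (suspension X) E (lower_cone X) \<phi> \<and>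
        (\<forall>b\<in>lower_cone X. oriented_fibre_isometry E b (\<phi> b)) \<and>
        trivialization_on (suspension X) E (upper_cone X) \<psi> \<and>
        (\<forall>b\<in>upper_cone X. oriented_fibre_isometry E b (\<psi> b)) \<and>
        (\<forall>x\<in>topspace X. \<forall>v. \<phi> (susp_pt X x (1/2)) v = \<psi> (susp_pt X x (1/2)) (g x *v v)))"

section \<open>The groups of homotopy classes and the turning obstruction\<close>

definition hclass :: "'a topology \<Rightarrow> ('a \<Rightarrow> real^'n^'n) \<Rightarrow> ('a \<Rightarrow> real^'n^'n) set" where
  "hclass X f = {h. homotopic_with (\<lambda>_. True) X (top_of_set SO) f h}"

text \<open>The product of two classes is the class of the pointwise product of representatives;
  taking the union over all representatives avoids choosing them.\<close>

definition homotopy_group_SO :: "'a topology \<Rightarrow> ('a \<Rightarrow> real^'n^'n) set monoid" where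
  "homotopy_group_SO X =
     \<lparr> carrier = {hclass X f | f. continuous_map X (top_of_set SO) f},
       monoid.mult = (\<lambda>P Q. \<Union>f\<in>P. \<Union>h\<in>Q. hclass X (\<lambda>x. f x ** h x)),
       one = hclass X (\<lambda>_. mat 1) \<rparr>"

text \<open>\<open>TO_map \<gamma> g [x,t] = g(x) \<gamma>(t) g(x)\<inverse>\<close>. If \<open>\<gamma>\<close> runs from \<open>1\<close> to \<open>-1\<close>, this has the
  same value on all pairs \<open>(x,t)\<close> in the class \<open>p = [x,t]\<close>.\<close>

definition TO_map ::
  "(real \<Rightarrow> real^'n^'n) \<Rightarrow> ('a \<Rightarrow> real^'n^'n) \<Rightarrow> ('a \<times> real) set \<Rightarrow> real^'n^'n" where
  "TO_map \<gamma> g p = the_elem ((\<lambda>(x,t). g x ** \<gamma> t ** matrix_inv (g x)) ` p)"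

definition TO ::
  "'a topology \<Rightarrow> (real \<Rightarrow> real^'n^'n) \<Rightarrow> ('a \<Rightarrow> real^'n^'n) set \<Rightarrow> (('a \<times> real) set \<Rightarrow> real^'n^'n) set" where
  "TO X \<gamma> P = (\<Union>g\<in>P. hclass (suspension X) (TO_map \<gamma> g))"

end

theory Submission
  imports Defs
begin

text \<open>
  Over each cone the bundle is trivial, so a turning amounts to two families of paths in the rotation
  group from \<open>1\<close> to \<open>-1\<close>, indexed by the points of the two cones; over the equator \<open>X\<close> they are
  conjugate by \<open>g\<close>. Contracting the cones shows that a \<open>\<gamma>\<close>-turning exists if and only if the family
  \<open>x \<mapsto> g x \<gamma> (g x)\<inverse>\<close> can be deformed, through families of paths with fixed endpoints, to the
  constant family \<open>\<gamma>\<close>. Such a deformation is a homotopy on the suspension from \<open>TO_map \<gamma> g\<close> to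
  \<open>[x,t] \<mapsto> \<gamma> t\<close>, and the latter map is null-homotopic because \<open>\<gamma>\<close> can be shrunk to its starting
  point. This gives \<open>null_homotopic_if_gamma_turnable\<close>.

  A free null-homotopy \<open>K\<close> of \<open>TO_map \<gamma> g\<close>, on the other hand, may move the values at the poles. For
  a base point \<open>x0\<close> and a path \<open>c\<close> of rotations from \<open>g x0\<close> to \<open>1\<close>, the formula
  \<open>K(r,[x,t]) K(r,[x0,t])\<inverse> c(r) \<gamma>(t) c(r)\<inverse>\<close> is a deformation that does fix them, which proves
  \<open>gamma_turnable_if_null_homotopic\<close>. The path exists by \<open>path_connected_SO\<close>; connectedness of the
  rotation group also makes the choice of frames in the fibres irrelevant.

  If \<open>X\<close> is a suspension, any two maps from \<open>X\<close> to the rotation group are homotopic to maps \<open>g\<close> and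
  \<open>h\<close> that are trivial on opposite cones (\<open>suspension_disjoint_supports\<close>). Then \<open>g\<close> and \<open>h\<close> commute
  pointwise, and \<open>(g h) \<gamma> (g h)\<inverse> = (g \<gamma> g\<inverse>) \<gamma>\<inverse> (h \<gamma> h\<inverse>)\<close>. The middle factor is
  null-homotopic, so the obstruction is a homomorphism.
\<close>

section \<open>The special orthogonal group\<close>

lemma orthogonal_matrix_inner:
  fixes A :: "real^'n^'n"
  assumes "orthogonal_matrix A"
  shows "(A *v x) \<bullet> (A *v y) = x \<bullet> y"
  using assms by (metis dot_lmul_matrix matrix_vector_mul_assoc matrix_vector_mul_lid orthogonal_matrix
      transpose_matrix_vector vector_transpose_matrix)

lemma SO_transpose_mult [simp]: "A \<in> SO \<Longrightarrow> transpose A ** A = mat 1" "A \<in> SO \<Longrightarrow> A ** transpose A = mat 1"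
  by (auto simp: SO_def rotation_matrix_def orthogonal_matrix_def)

lemma SO_cancel_left [simp]:
  "A \<in> SO \<Longrightarrow> transpose A ** (A ** B) = B" "A \<in> SO \<Longrightarrow> A ** (transpose A ** B) = B"
  by (simp_all add: matrix_mul_assoc)

lemma mat_1_in_SO [simp]: "mat 1 \<in> SO"
  by (simp add: SO_def rotation_matrix_def orthogonal_matrix_id)

lemma SO_mult [simp]: "A \<in> SO \<Longrightarrow> B \<in> SO \<Longrightarrow> A ** B \<in> SO"
  by (simp add: SO_def rotation_matrix_def orthogonal_matrix_mul det_mul)

lemma SO_transpose [simp]: "A \<in> SO \<Longrightarrow> transpose A \<in> SO"
  by (simp add: SO_def rotation_matrix_def)

lemma matrix_inv_SO: "A \<in> SO \<Longrightarrow> matrix_inv A = transpose A"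
  unfolding matrix_inv_def
  by (rule some_equality) (auto, metis SO_cancel_left(1) matrix_mul_rid)

lemma minus_matrix_mult [simp]:
  fixes A B :: "real^'n^'n"
  shows "(- A) ** B = - (A ** B)" "A ** (- B) = - (A ** B)"
  by (simp_all add: matrix_matrix_mult_def vec_eq_iff sum_negf)

lemma minus_matrix_vector_mult: "(- A) *v v = - (A *v v :: real^'n)"
  by (simp add: matrix_vector_mult_def vec_eq_iff sum_negf)

text \<open>For a unit vector \<open>u\<close>, the matrix \<open>1 - 2 u u\<^sup>T\<close> of the reflection in the hyperplane orthogonal
  to \<open>u\<close>.\<close>

definition hyperplane_reflection :: "real^'n \<Rightarrow> real^'n^'n" where
  "hyperplane_reflection u = (\<chi> i j. (if i = j then 1 else 0) - 2 * u $ i * u $ j)"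

lemma hyperplane_reflection_vec: "hyperplane_reflection u *v x = x - (2 * (u \<bullet> x)) *\<^sub>R u"
proof -
  have "(\<Sum>j\<in>UNIV. (if i = j then 1 else 0) * x $ j) = x $ i" for i
    by (simp add: if_distrib[of "\<lambda>c. c * _"] cong: if_cong)
  then show ?thesis
    by (simp add: hyperplane_reflection_def matrix_vector_mult_def vec_eq_iff inner_vec_def
        left_diff_distrib right_diff_distrib sum_subtractf sum_distrib_left mult_ac)
qed

lemma hyperplane_reflection_square:
  assumes "norm u = 1"
  shows "hyperplane_reflection u ** hyperplane_reflection u = mat 1"
proof -
  have "u \<bullet> u = 1"
    using assms by (simp add: dot_square_norm)
  then show ?thesis
    by (simp add: matrix_eq hyperplane_reflection_vec inner_diff_right flip: matrix_vector_mul_assoc)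
qed

lemma orthogonal_matrix_hyperplane_reflection:
  assumes "norm u = 1"
  shows "orthogonal_matrix (hyperplane_reflection u)"
proof -
  have "transpose (hyperplane_reflection u) = hyperplane_reflection u"
    by (simp add: hyperplane_reflection_def transpose_def vec_eq_iff)
  then show ?thesis
    using hyperplane_reflection_square[OF assms] by (simp add: orthogonal_matrix)
qed

lemma path_component_continuous_image:
  assumes "path_component S x y" "continuous_on S f" "f ` S \<subseteq> T"
  shows "path_component T (f x) (f y)"
proof -
  obtain p where p: "path p" "path_image p \<subseteq> S" "pathstart p = x" "pathfinish p = y"
    using assms(1) unfolding path_component_def by blast
  have "path (f \<circ> p)"
    using assms(2) p by (meson continuous_on_subset path_continuous_image)
  moreover have "path_image (f \<circ> p) \<subseteq> T"
    using assms(3) p by (auto simp: path_image_compose)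
  ultimately show ?thesis
    unfolding path_component_def using p by (metis pathfinish_compose pathstart_compose)
qed

lemma continuous_on_matrix_mult [continuous_intros]:
  fixes f :: "'a::topological_space \<Rightarrow> real^'n^'m" and h :: "'a \<Rightarrow> real^'p^'n"
  assumes "continuous_on S f" "continuous_on S h"
  shows "continuous_on S (\<lambda>x. f x ** h x)"
  unfolding matrix_matrix_mult_def
  by (intro continuous_on_vec_lambda continuous_on_sum continuous_on_mult continuous_on_component assms)

lemma continuous_on_transpose [continuous_intros]:
  fixes f :: "'a::topological_space \<Rightarrow> real^'n^'m"
  assumes "continuous_on S f"
  shows "continuous_on S (\<lambda>x. transpose (f x))"
  unfolding transpose_def
  by (intro continuous_on_vec_lambda continuous_on_component assms)

lemma path_component_hyperplane_reflection:
  fixes u v :: "real^'n"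
  assumes "2 \<le> CARD('n)" "norm u = 1" "norm v = 1"
  shows "path_component (Collect orthogonal_matrix) (hyperplane_reflection u) (hyperplane_reflection v)"
proof -
  have "path_connected (sphere (0::real^'n) 1)"
    using assms by (intro path_connected_sphere) auto
  then have "path_component (sphere 0 1) u v"
    using assms by (auto simp: path_connected_component)
  moreover have "continuous_on (sphere 0 1) (hyperplane_reflection :: real^'n \<Rightarrow> _)"
    unfolding hyperplane_reflection_def
    by (intro continuous_on_vec_lambda continuous_intros)
  moreover have "hyperplane_reflection ` sphere (0::real^'n) 1 \<subseteq> Collect orthogonal_matrix"
    by (auto simp: orthogonal_matrix_hyperplane_reflection)
  ultimately show ?thesis
    by (rule path_component_continuous_image)
qed

lemma path_component_orthogonal_mult_left:
  assumes "path_component (Collect orthogonal_matrix) A B" "orthogonal_matrix C"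
  shows "path_component (Collect orthogonal_matrix) (C ** A) (C ** (B :: real^'n^'n))"
  by (rule path_component_continuous_image[OF assms(1)])
    (auto intro!: continuous_intros orthogonal_matrix_mul assms)

lemma path_component_orthogonal_mult_right:
  assumes "path_component (Collect orthogonal_matrix) A B" "orthogonal_matrix C"
  shows "path_component (Collect orthogonal_matrix) (A ** C) ((B :: real^'n^'n) ** C)"
  by (rule path_component_continuous_image[OF assms(1)])
    (auto intro!: continuous_intros orthogonal_matrix_mul assms)

text \<open>The inductive step of the Cartan--Dieudonne theorem: if \<open>A v \<noteq> v\<close>, the reflection exchanging
  \<open>A v\<close> and \<open>v\<close> fixes every fixed vector of \<open>A\<close>, because \<open>A v - v\<close> is orthogonal to it.\<close>

lemma orthogonal_matrix_reflection_step:
  fixes A :: "real^'n^'n"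
  assumes A: "orthogonal_matrix A" and "A \<noteq> mat 1"
  obtains u where "norm u = 1"
    "dim {x. A *v x = x} < dim {x. (hyperplane_reflection u ** A) *v x = x}"
proof -
  obtain v where v: "A *v v \<noteq> v"
    using assms(2) by (metis matrix_eq matrix_vector_mul_lid)
  define w where "w = A *v v - v"
  define u where "u = w /\<^sub>R norm w"
  have w: "w \<noteq> 0"
    using v by (simp add: w_def)
  have refl: "hyperplane_reflection u *v x = x - (2 * (w \<bullet> x) / (w \<bullet> w)) *\<^sub>R w" for x
    by (simp add: hyperplane_reflection_vec u_def dot_square_norm power2_eq_square field_simps)
  have "w \<bullet> w = 2 * (w \<bullet> (A *v v))"
    using orthogonal_matrix_inner[OF A, of v v]
    by (simp add: w_def inner_diff_left inner_diff_right inner_commute)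
  moreover have "w \<bullet> w \<noteq> 0"
    using w by simp
  ultimately have "hyperplane_reflection u *v (A *v v) = A *v v - 1 *\<^sub>R w"
    unfolding refl by (metis div_self)
  then have "hyperplane_reflection u *v (A *v v) = v"
    by (simp add: w_def)
  then have v': "(hyperplane_reflection u ** A) *v v = v"
    by (simp add: matrix_vector_mul_assoc)
  have fixed: "(hyperplane_reflection u ** A) *v x = x" if "A *v x = x" for x
  proof -
    have "w \<bullet> x = 0"
      using orthogonal_matrix_inner[OF A, of v x] that by (simp add: w_def inner_diff_left)
    then show ?thesis
      using that by (simp add: refl flip: matrix_vector_mul_assoc)
  qed
  have sub: "subspace {x. B *v x = x}" for B :: "real^'n^'n"
    by (auto simp: subspace_def matrix_vector_right_distrib scaleR_matrix_vector_assoc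
        matrix_vector_mult_scaleR)
  have "{x. A *v x = x} \<subset> {x. (hyperplane_reflection u ** A) *v x = x}"
    using fixed v v' by blast
  then have "dim {x. A *v x = x} < dim {x. (hyperplane_reflection u ** A) *v x = x}"
    using sub by (intro dim_psubset) (simp add: span_eq_iff[THEN iffD2])
  then show thesis
    using that[of u] w by (simp add: u_def)
qed

text \<open>An orthogonal matrix is a product of reflections. As the unit sphere is path connected, each of
  them can be moved to one fixed reflection \<open>R\<close>; only the parity of their number remains, since
  \<open>R\<^sup>2 = 1\<close>.\<close>

lemma path_component_orthogonal_cases:
  fixes A :: "real^'n^'n" and e :: "real^'n"
  assumes "2 \<le> CARD('n)" "norm e = 1" "orthogonal_matrix A"
  shows "path_component (Collect orthogonal_matrix) A (mat 1) \<or>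
    path_component (Collect orthogonal_matrix) A (hyperplane_reflection e)"
  using assms(3)
proof (induction "CARD('n) - dim {x. A *v x = x}" arbitrary: A rule: less_induct)
  case less
  let ?O = "Collect orthogonal_matrix :: (real^'n^'n) set"
  show ?case
  proof (cases "A = mat 1")
    case True
    then show ?thesis
      by (simp add: path_component_refl_eq orthogonal_matrix_id)
  next
    case False
    obtain u where u: "norm u = 1"
      "dim {x. A *v x = x} < dim {x. (hyperplane_reflection u ** A) *v x = x}"
      by (rule orthogonal_matrix_reflection_step[OF less.prems False])
    let ?R = "hyperplane_reflection u"
    have R: "orthogonal_matrix ?R"
      by (rule orthogonal_matrix_hyperplane_reflection[OF u(1)])
    have "dim {x. (?R ** A) *v x = x} \<le> CARD('n)"
      using dim_subset_UNIV_cart by blast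
    then have less': "CARD('n) - dim {x. (?R ** A) *v x = x} < CARD('n) - dim {x. A *v x = x}"
      using u(2) by simp
    have "path_component ?O (?R ** A) (mat 1) \<or> path_component ?O (?R ** A) (hyperplane_reflection e)"
      by (rule less.hyps[OF less' orthogonal_matrix_mul[OF R less.prems]])
    then have "path_component ?O (?R ** (?R ** A)) (?R ** mat 1) \<or>
        path_component ?O (?R ** (?R ** A)) (?R ** hyperplane_reflection e)"
      using path_component_orthogonal_mult_left[OF _ R] by blast
    then have "path_component ?O A ?R \<or> path_component ?O A (?R ** hyperplane_reflection e)"
      by (simp add: matrix_mul_assoc hyperplane_reflection_square[OF u(1)])
    moreover have Re: "path_component ?O ?R (hyperplane_reflection e)"
      using path_component_hyperplane_reflection assms u by blast
    moreover have "path_component ?O (?R ** hyperplane_reflection e) (mat 1)"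
      using path_component_orthogonal_mult_right[OF Re orthogonal_matrix_hyperplane_reflection[OF assms(2)]]
        hyperplane_reflection_square[OF assms(2)] by simp
    ultimately show ?thesis
      by (meson path_component_trans)
  qed
qed

lemma det_eq_on_orthogonal_path_component:
  assumes "path_component (Collect orthogonal_matrix) A (B :: real^'n^'n)"
  shows "det A = det B"
proof -
  obtain p where p: "path p" "path_image p \<subseteq> Collect orthogonal_matrix" "pathstart p = A" "pathfinish p = B"
    using assms unfolding path_component_def by blast
  have "continuous_on {0..1} (\<lambda>t. det (p t))"
    using p(1) unfolding path_def det_def
    by (intro continuous_intros continuous_on_component)
  moreover have "(\<lambda>t. det (p t)) ` {0..1} \<subseteq> {1, -1}"
    using p(2) det_orthogonal_matrix unfolding path_image_def by blast
  ultimately have "(\<lambda>t. det (p t)) constant_on {0..1}"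
    by (intro continuous_finite_range_constant) (auto intro: finite_subset)
  then have "det (p 0) = det (p 1)"
    unfolding constant_on_def by fastforce
  then show ?thesis
    using p by (simp add: pathstart_def pathfinish_def)
qed

text \<open>Along a path of orthogonal matrices the determinant, being \<open>\<plusminus>1\<close>, is constant. So a rotation
  cannot be joined to a reflection, and a path that joins it to \<open>1\<close> consists of rotations.\<close>

lemma path_connected_SO:
  assumes "2 \<le> CARD('n)"
  shows "path_connected (SO :: (real^'n^'n) set)"
proof -
  let ?O = "Collect orthogonal_matrix :: (real^'n^'n) set"
  have "path_component SO A (mat 1)" if A: "A \<in> SO" for A :: "real^'n^'n"
  proof -
    define e :: "real^'n" where "e = axis undefined 1"
    have e: "norm e = 1"
      by (simp add: e_def)
    have "path_component ?O A (mat 1)"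
    proof (rule ccontr)
      assume no: "\<not> path_component ?O A (mat 1)"
      let ?R = "hyperplane_reflection e"
      have AR: "path_component ?O A ?R"
        using path_component_orthogonal_cases[OF assms e, of A] A no
        by (auto simp: SO_def rotation_matrix_def)
      have "det ?R = -1"
      proof -
        \<comment> \<open>reflection in a coordinate vector changes the sign of one row of the unit matrix\<close>
        have "?R = (\<chi> i. (if i = undefined then -1 else 1) *s mat 1 $ i)"
          by (auto simp: hyperplane_reflection_def e_def vec_eq_iff mat_def axis_def)
        then show ?thesis
          using det_rows_mul[of "\<lambda>i. if i = undefined then -1 else 1" "\<lambda>i. mat 1 $ i :: real^'n"]
          by (simp add: prod.delta vec_lambda_eta)
      qed
      then show False
        using det_eq_on_orthogonal_path_component[OF AR] A by (simp add: SO_def rotation_matrix_def)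
    qed
    then obtain p where p: "path p" "path_image p \<subseteq> ?O" "pathstart p = A" "pathfinish p = mat 1"
      unfolding path_component_def by blast
    have "p t \<in> SO" if "t \<in> {0..1}" for t
    proof -
      have "path_component (path_image p) (pathstart p) (p t)"
        using that by (intro path_component_path_image_pathstart p) (auto simp: path_image_def)
      then have "path_component ?O A (p t)"
        using p path_component_of_subset by metis
      then have "det (p t) = 1" "orthogonal_matrix (p t)"
        using A det_eq_on_orthogonal_path_component path_component_mem
        by (fastforce simp: SO_def rotation_matrix_def)+
      then show ?thesis
        by (simp add: SO_def rotation_matrix_def)
    qed
    then show ?thesis
      unfolding path_component_def using p by (auto simp: path_image_def)
  qed
  then show ?thesis
    unfolding path_connected_component by (meson path_component_sym path_component_trans)
qed

section \<open>Continuous maps into the special orthogonal group\<close>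

abbreviation unit_interval :: "real topology" where
  "unit_interval \<equiv> top_of_set {0..1}"

lemma continuous_map_compose_pt:
  "continuous_map Z X f \<Longrightarrow> continuous_map X Y h \<Longrightarrow> continuous_map Z Y (\<lambda>z. h (f z))"
  using continuous_map_compose unfolding o_def by blast

lemma continuous_map_fst_snd: "continuous_map (prod_topology X (prod_topology Y Z)) Y (\<lambda>z. fst (snd z))"
  by (rule continuous_map_compose_pt[OF continuous_map_snd continuous_map_fst])

lemma continuous_map_snd_snd: "continuous_map (prod_topology X (prod_topology Y Z)) Z (\<lambda>z. snd (snd z))"
  by (rule continuous_map_compose_pt[OF continuous_map_snd continuous_map_snd])

lemmas continuous_map_coordinates =
  continuous_map_fst continuous_map_snd continuous_map_fst_snd continuous_map_snd_snd

lemma continuous_map_SO_iff: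
  "continuous_map Z (top_of_set SO) f \<longleftrightarrow> continuous_map Z euclidean f \<and> (\<forall>z\<in>topspace Z. f z \<in> SO)"
  by (auto simp: continuous_map_in_subtopology)

lemma continuous_map_SO_mem: "continuous_map Z (top_of_set SO) f \<Longrightarrow> z \<in> topspace Z \<Longrightarrow> f z \<in> SO"
  by (simp add: continuous_map_SO_iff)

lemma continuous_map_matrix_mult:
  fixes f :: "'a \<Rightarrow> real^'n^'m" and h :: "'a \<Rightarrow> real^'p^'n"
  assumes "continuous_map Z euclidean f" "continuous_map Z euclidean h"
  shows "continuous_map Z euclidean (\<lambda>z. f z ** h z)"
proof -
  have "continuous_map (prod_topology euclidean euclidean) euclidean
      (\<lambda>p::(real^'n^'m) \<times> (real^'p^'n). fst p ** snd p)"
    by (simp add: continuous_on_matrix_mult continuous_on_fst continuous_on_snd)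
  from continuous_map_compose_pt[OF continuous_map_pairedI[OF assms] this] show ?thesis
    by simp
qed

lemma continuous_map_SO_mult:
  assumes "continuous_map Z (top_of_set SO) f" "continuous_map Z (top_of_set SO) h"
  shows "continuous_map Z (top_of_set SO) (\<lambda>z. f z ** h z)"
  using assms by (simp add: continuous_map_SO_iff continuous_map_matrix_mult)

lemma continuous_map_SO_transpose:
  fixes f :: "'a \<Rightarrow> real^'n^'n"
  assumes "continuous_map Z (top_of_set SO) f"
  shows "continuous_map Z (top_of_set SO) (\<lambda>z. transpose (f z))"
proof -
  have tr: "continuous_map euclidean euclidean (transpose :: real^'n^'n \<Rightarrow> real^'n^'n)"
    by (simp add: continuous_on_transpose continuous_on_id)
  have f: "continuous_map Z euclidean f" "\<And>z. z \<in> topspace Z \<Longrightarrow> f z \<in> SO"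
    using assms by (simp_all add: continuous_map_SO_iff)
  show ?thesis
    using continuous_map_compose_pt[OF f(1) tr] f(2) by (simp add: continuous_map_SO_iff)
qed

lemmas continuous_map_SO_intros =
  continuous_map_SO_mult continuous_map_SO_transpose continuous_map_coordinates continuous_map_pairedI

abbreviation homotopic_SO :: "'a topology \<Rightarrow> ('a \<Rightarrow> real^'n^'n) \<Rightarrow> ('a \<Rightarrow> real^'n^'n) \<Rightarrow> bool" where
  "homotopic_SO X \<equiv> homotopic_with (\<lambda>_. True) X (top_of_set SO)"

lemma homotopic_SO_mult:
  assumes "homotopic_SO X f f'" "homotopic_SO X h h'"
  shows "homotopic_SO X (\<lambda>x. f x ** h x) (\<lambda>x. f' x ** h' x)"
proof -
  obtain F H where
    F: "continuous_map (prod_topology unit_interval X) (top_of_set SO) F" "\<forall>x. F (0,x) = f x" "\<forall>x. F (1,x) = f' x" and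
    H: "continuous_map (prod_topology unit_interval X) (top_of_set SO) H" "\<forall>x. H (0,x) = h x" "\<forall>x. H (1,x) = h' x"
    using assms unfolding homotopic_with_def by blast
  show ?thesis
    unfolding homotopic_with_def using F H
    by (intro exI[of _ "\<lambda>z. F z ** H z"]) (auto intro: continuous_map_SO_mult)
qed

lemma homotopic_SO_cong:
  assumes "homotopic_SO X f h"
    and "\<And>x. x \<in> topspace X \<Longrightarrow> f x = f' x" "\<And>x. x \<in> topspace X \<Longrightarrow> h x = h' x"
  shows "homotopic_SO X f' h'"
  using assms(1) by (rule homotopic_with_eq) (simp_all add: assms(2,3))

lemma homotopic_SO_const:
  assumes "2 \<le> CARD('n)" "A \<in> SO" "B \<in> SO"
  shows "homotopic_SO X (\<lambda>_. A :: real^'n^'n) (\<lambda>_. B)"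
proof -
  obtain p where p: "path p" "path_image p \<subseteq> SO" "pathstart p = A" "pathfinish p = B"
    using path_connected_SO[OF assms(1)] assms(2,3) unfolding path_connected_def by blast
  have "continuous_map unit_interval (top_of_set SO) p"
    using p by (auto simp: path_def path_image_def)
  then have "continuous_map (prod_topology unit_interval X) (top_of_set SO) (\<lambda>z. p (fst z))"
    by (rule continuous_map_compose_pt[OF continuous_map_fst])
  then show ?thesis
    unfolding homotopic_with_def using p
    by (intro exI[of _ "\<lambda>z. p (fst z)"]) (simp add: pathstart_def pathfinish_def)
qed

lemma homotopic_SO_empty:
  assumes "topspace X = {}"
  shows "homotopic_SO X f h"
  using assms by (intro homotopic_with_equal) (auto simp: continuous_map_def)

section \<open>The group of homotopy classes\<close>

lemma hclass_self: "continuous_map X (top_of_set SO) f \<Longrightarrow> f \<in> hclass X f"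
  by (simp add: hclass_def)

lemma hclass_eq_iff:
  assumes "continuous_map X (top_of_set SO) f"
  shows "hclass X f = hclass X h \<longleftrightarrow> homotopic_SO X f h"
proof
  assume "hclass X f = hclass X h"
  then show "homotopic_SO X f h"
    using hclass_self[OF assms] by (auto simp: hclass_def homotopic_with_sym)
next
  assume "homotopic_SO X f h"
  then show "hclass X f = hclass X h"
    by (auto simp: hclass_def intro: homotopic_with_trans homotopic_with_symD)
qed

text \<open>All products of representatives are homotopic, so the union in the definition of the product
  consists of a single class.\<close>

lemma mult_hclass:
  assumes "continuous_map X (top_of_set SO) f" "continuous_map X (top_of_set SO) h"
  shows "hclass X f \<otimes>\<^bsub>homotopy_group_SO X\<^esub> hclass X h = hclass X (\<lambda>x. f x ** h x)"
proof -
  have *: "hclass X (\<lambda>x. f' x ** h' x) = hclass X (\<lambda>x. f x ** h x)"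
    if "f' \<in> hclass X f" "h' \<in> hclass X h" for f' h'
  proof -
    have "homotopic_SO X (\<lambda>x. f x ** h x) (\<lambda>x. f' x ** h' x)"
      using that by (intro homotopic_SO_mult) (simp_all add: hclass_def)
    then show ?thesis
      by (rule hclass_eq_iff[OF continuous_map_SO_mult[OF assms], THEN iffD2, symmetric])
  qed
  have "(\<Union>f'\<in>hclass X f. \<Union>h'\<in>hclass X h. hclass X (\<lambda>x. f' x ** h' x)) =
      (\<Union>f'\<in>hclass X f. \<Union>h'\<in>hclass X h. hclass X (\<lambda>x. f x ** h x))"
    by (intro SUP_cong refl *)
  also have "\<dots> = hclass X (\<lambda>x. f x ** h x)"
    using hclass_self[OF assms(1)] hclass_self[OF assms(2)] by (auto simp only: UN_constant split: if_splits)
  finally show ?thesis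
    by (simp add: homotopy_group_SO_def)
qed

lemma carrier_homotopy_group_SO:
  "carrier (homotopy_group_SO X) = {hclass X f | f. continuous_map X (top_of_set SO) f}"
  by (simp add: homotopy_group_SO_def)

lemma one_homotopy_group_SO: "\<one>\<^bsub>homotopy_group_SO X\<^esub> = hclass X (\<lambda>_. mat 1)"
  by (simp add: homotopy_group_SO_def)

lemma continuous_map_SO_one: "continuous_map X (top_of_set SO) (\<lambda>_. mat 1)"
  by simp

lemma group_homotopy_group_SO: "group (homotopy_group_SO X)"
proof (rule groupI, goal_cases)
  case (1 x y)
  then show ?case
    by (auto simp: carrier_homotopy_group_SO mult_hclass intro: continuous_map_SO_mult)
next
  case 2
  then show ?case
    using continuous_map_SO_one by (auto simp: carrier_homotopy_group_SO one_homotopy_group_SO)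
next
  case (3 x y z)
  then show ?case
    by (auto simp: carrier_homotopy_group_SO mult_hclass continuous_map_SO_mult matrix_mul_assoc)
next
  case (4 x)
  then show ?case
    by (auto simp: carrier_homotopy_group_SO one_homotopy_group_SO mult_hclass continuous_map_SO_one)
next
  case (5 x)
  then obtain f where f: "x = hclass X f" "continuous_map X (top_of_set SO) f"
    by (auto simp: carrier_homotopy_group_SO)
  let ?f' = "\<lambda>x. transpose (f x)"
  have f': "continuous_map X (top_of_set SO) ?f'"
    by (rule continuous_map_SO_transpose[OF f(2)])
  have "homotopic_SO X (\<lambda>x. ?f' x ** f x) (\<lambda>_. mat 1)"
    using f(2) f' by (intro homotopic_with_equal)
      (auto intro: continuous_map_SO_mult simp: continuous_map_SO_mem)
  then have "hclass X ?f' \<otimes>\<^bsub>homotopy_group_SO X\<^esub> x = \<one>\<^bsub>homotopy_group_SO X\<^esub>"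
    using f f' by (simp add: mult_hclass one_homotopy_group_SO hclass_eq_iff continuous_map_SO_mult)
  then show ?case
    using f' by (auto simp: carrier_homotopy_group_SO)
qed

section \<open>Maps out of the suspension\<close>

lemma susp_pt_0 [simp]: "susp_pt X x 0 = topspace X \<times> {0}"
  and susp_pt_1 [simp]: "susp_pt X x 1 = topspace X \<times> {1}"
  by (auto simp: susp_pt_def)

lemma topspace_suspension:
  "topspace (suspension X) = (\<lambda>(x,t). susp_pt X x t) ` (topspace X \<times> {0..1})"
  using quotient_imp_surjective_map[OF quotient_map_suspension[of X]] by simp

lemma susp_pt_in_suspension [simp]:
  "x \<in> topspace X \<Longrightarrow> 0 \<le> t \<Longrightarrow> t \<le> 1 \<Longrightarrow> susp_pt X x t \<in> topspace (suspension X)"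
  by (auto simp: topspace_suspension)

lemma suspension_cases:
  assumes "p \<in> topspace (suspension X)"
  obtains x t where "x \<in> topspace X" "t \<in> {0..1}" "p = susp_pt X x t"
  using assms by (auto simp: topspace_suspension)

lemma continuous_map_susp_pt:
  assumes "continuous_map Z X f" "continuous_map Z unit_interval h"
  shows "continuous_map Z (suspension X) (\<lambda>z. susp_pt X (f z) (h z))"
  using continuous_map_compose_pt[OF continuous_map_pairedI[OF assms]
      quotient_imp_continuous_map[OF quotient_map_suspension]] by simp

text \<open>These are the maps on the cylinder that factor through the suspension; \<open>susp_lift\<close> is the
  resulting map on the quotient.\<close>

definition constant_on_ends :: "'a topology \<Rightarrow> ('a \<times> real \<Rightarrow> 'b) \<Rightarrow> bool" where
  "constant_on_ends X F \<longleftrightarrow>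
     (\<forall>x\<in>topspace X. \<forall>y\<in>topspace X. F (x,0) = F (y,0) \<and> F (x,1) = F (y,1))"

definition susp_lift :: "('a \<times> real \<Rightarrow> 'b) \<Rightarrow> ('a \<times> real) set \<Rightarrow> 'b" where
  "susp_lift F p = the_elem (F ` p)"

lemma susp_lift_susp_pt:
  assumes "constant_on_ends X F" "x \<in> topspace X"
  shows "susp_lift F (susp_pt X x t) = F (x,t)"
proof -
  have "F ` susp_pt X x t = {F (x,t)}"
    using assms unfolding susp_pt_def constant_on_ends_def by auto
  then show ?thesis
    by (simp add: susp_lift_def)
qed

text \<open>A product of a quotient map with the unit interval is again a quotient map because the interval
  is locally compact; this is what makes homotopies descend to the suspension of an arbitrary space.\<close>

lemma continuous_map_susp_lift:
  assumes F: "continuous_map (prod_topology unit_interval (prod_topology X unit_interval)) Y F"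
    and ends: "\<And>r. r \<in> {0..1} \<Longrightarrow> constant_on_ends X (\<lambda>q. F (r,q))"
  shows "continuous_map (prod_topology unit_interval (suspension X)) Y
    (\<lambda>(r,p). susp_lift (\<lambda>q. F (r,q)) p)"
proof (rule continuous_compose_quotient_map)
  show "quotient_map (prod_topology unit_interval (prod_topology X unit_interval))
      (prod_topology unit_interval (suspension X)) (\<lambda>(r,q). (r, (\<lambda>(x,t). susp_pt X x t) q))"
  proof (rule quotient_map_prod_right[OF _ _ quotient_map_suspension])
    show "locally_compact_space unit_interval"
      by (intro compact_imp_locally_compact_space) (simp add: compact_space_subtopology)
    show "Hausdorff_space unit_interval \<or> regular_space unit_interval"
      by (simp add: Hausdorff_space_subtopology)
  qed
  show "continuous_map (prod_topology unit_interval (prod_topology X unit_interval)) Y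
      ((\<lambda>(r,p). susp_lift (\<lambda>q. F (r,q)) p) \<circ> (\<lambda>(r,q). (r, (\<lambda>(x,t). susp_pt X x t) q)))"
    by (rule continuous_map_eq[OF F]) (auto simp: susp_lift_susp_pt ends)
qed

text \<open>The form in which homotopies on the suspension are constructed: on the cylinder, with both ends
  collapsed at every time.\<close>

lemma homotopic_suspensionI:
  assumes F: "continuous_map (prod_topology unit_interval (prod_topology X unit_interval)) Y F"
    and ends: "\<And>r. r \<in> {0..1} \<Longrightarrow> constant_on_ends X (\<lambda>q. F (r,q))"
    and F0: "\<And>x t. x \<in> topspace X \<Longrightarrow> t \<in> {0..1} \<Longrightarrow> F (0,(x,t)) = f (susp_pt X x t)"
    and F1: "\<And>x t. x \<in> topspace X \<Longrightarrow> t \<in> {0..1} \<Longrightarrow> F (1,(x,t)) = h (susp_pt X x t)"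
  shows "homotopic_with (\<lambda>_. True) (suspension X) Y f h"
proof -
  have hom: "homotopic_with (\<lambda>_. True) (suspension X) Y (susp_lift (\<lambda>q. F (0,q))) (susp_lift (\<lambda>q. F (1,q)))"
    unfolding homotopic_with_def using continuous_map_susp_lift[OF F ends]
    by (intro exI[of _ "\<lambda>(r,p). susp_lift (\<lambda>q. F (r,q)) p"]) simp
  have eq: "f p = susp_lift (\<lambda>q. F (0,q)) p \<and> h p = susp_lift (\<lambda>q. F (1,q)) p"
    if p: "p \<in> topspace (suspension X)" for p
  proof -
    obtain x t where "x \<in> topspace X" "t \<in> {0..1}" "p = susp_pt X x t"
      using p by (rule suspension_cases)
    then show ?thesis
      using ends[of 0] ends[of 1] F0 F1 by (simp add: susp_lift_susp_pt)
  qed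
  show ?thesis
    by (rule homotopic_with_eq[OF hom eq[THEN conjunct1] eq[THEN conjunct2]]) simp_all
qed

text \<open>Sliding points along the suspension coordinate, with fixed poles, does not change a homotopy class.\<close>

lemma homotopic_suspension_reparametrization:
  assumes f: "continuous_map (suspension Y) Z f"
    and e: "continuous_map (prod_topology unit_interval unit_interval) unit_interval e"
    and e0: "\<And>t. t \<in> {0..1} \<Longrightarrow> e (0,t) = t"
    and ends: "\<And>r. r \<in> {0..1} \<Longrightarrow> e (r,0) = 0 \<and> e (r,1) = 1"
  shows "homotopic_with (\<lambda>_. True) (suspension Y) Z f (susp_lift (\<lambda>(y,t). f (susp_pt Y y (e (1,t)))))"
proof -
  let ?F = "\<lambda>z. f (susp_pt Y (fst (snd z)) (e (fst z, snd (snd z))))"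
  have c: "constant_on_ends Y (\<lambda>q. ?F (r,q))" if "r \<in> {0..1}" for r
    using ends[OF that] by (simp add: constant_on_ends_def)
  have "susp_lift (\<lambda>(y,t). f (susp_pt Y y (e (1,t)))) (susp_pt Y y t) = f (susp_pt Y y (e (1,t)))"
    if "y \<in> topspace Y" for y t
    using susp_lift_susp_pt[of Y "\<lambda>(y,t). f (susp_pt Y y (e (1,t)))"] ends[of 1] that
    by (simp add: constant_on_ends_def)
  then show ?thesis
    by (intro homotopic_suspensionI[of Y Z ?F] c continuous_map_compose_pt[OF _ f] continuous_map_susp_pt
        continuous_map_compose_pt[OF _ e] continuous_map_coordinates continuous_map_pairedI)
      (simp_all add: e0)
qed

section \<open>Homotopy classes on a suspension commute\<close>

text \<open>A reparametrization that maps part of the interval to the pole \<open>c\<close> makes \<open>f\<close> constant over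
  that part; as maps are not based, this constant need not be \<open>1\<close>, and \<open>f\<close> is multiplied by its inverse,
  which a path in the rotation group joins to \<open>1\<close>.\<close>

lemma suspension_pinch:
  fixes f :: "('a \<times> real) set \<Rightarrow> real^'n^'n"
  assumes n: "2 \<le> CARD('n)" and f: "continuous_map (suspension Y) (top_of_set SO) f"
    and e: "continuous_map (prod_topology unit_interval unit_interval) unit_interval e"
    and e0: "\<And>t. t \<in> {0..1} \<Longrightarrow> e (0,t) = t"
    and ends: "\<And>r. r \<in> {0..1} \<Longrightarrow> e (r,0) = 0 \<and> e (r,1) = 1"
    and c: "c = 0 \<or> c = 1"
  shows "\<exists>f'. homotopic_SO (suspension Y) f f' \<and>
    (\<forall>y\<in>topspace Y. \<forall>t\<in>{0..1}. e (1,t) = c \<longrightarrow> f' (susp_pt Y y t) = mat 1)"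
proof (cases "topspace Y = {}")
  case True
  then show ?thesis
    using f by (intro exI[of _ f]) auto
next
  case False
  then obtain y0 where y0: "y0 \<in> topspace Y"
    by blast
  define B where "B = f (susp_pt Y y0 c)"
  define f1 where "f1 = susp_lift (\<lambda>(y,t). f (susp_pt Y y (e (1,t))))"
  have B: "B \<in> SO"
    unfolding B_def using c y0 by (intro continuous_map_SO_mem[OF f] susp_pt_in_suspension) auto
  have f1: "homotopic_SO (suspension Y) f f1"
    unfolding f1_def by (rule homotopic_suspension_reparametrization[OF f e e0 ends])
  have "homotopic_SO (suspension Y) (\<lambda>p. mat 1 ** f p) (\<lambda>p. transpose B ** f1 p)"
    by (intro homotopic_SO_mult homotopic_SO_const f1 n) (auto simp: B)
  moreover have "transpose B ** f1 (susp_pt Y y t) = mat 1"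
    if "y \<in> topspace Y" "t \<in> {0..1}" "e (1,t) = c" for y t
  proof -
    have "constant_on_ends Y (\<lambda>(y,t). f (susp_pt Y y (e (1,t))))"
      using ends[of 1] by (simp add: constant_on_ends_def)
    then have "f1 (susp_pt Y y t) = f (susp_pt Y y c)"
      using that by (simp add: f1_def susp_lift_susp_pt)
    then show ?thesis
      using c B by (auto simp: B_def)
  qed
  ultimately show ?thesis
    by auto
qed

text \<open>Pinching one map over the upper and the other over the lower half of the suspension makes them
  trivial on complementary cones; as in the Eckmann--Hilton argument, this is what makes products
  commute.\<close>

lemma suspension_disjoint_supports:
  fixes f h :: "'a \<Rightarrow> real^'n^'n"
  assumes n: "2 \<le> CARD('n)" and X: "X homeomorphic_space suspension Y"
    and f: "continuous_map X (top_of_set SO) f" and h: "continuous_map X (top_of_set SO) h"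
  obtains f' h' where "homotopic_SO X f f'" "homotopic_SO X h h'"
    "\<forall>x\<in>topspace X. f' x = mat 1 \<or> h' x = mat 1"
proof -
  obtain d d' where d: "homeomorphic_maps X (suspension Y) d d'"
    using X unfolding homeomorphic_space_def by blast
  have dc: "continuous_map X (suspension Y) d" and d'c: "continuous_map (suspension Y) X d'"
    and d'd: "\<And>x. x \<in> topspace X \<Longrightarrow> d' (d x) = x"
    using d unfolding homeomorphic_maps_def by auto
  \<comment> \<open>at time 1 these are constant on the upper and on the lower half of the interval, respectively\<close>
  let ?up = "\<lambda>z::real \<times> real. min 1 ((1 + fst z) * snd z)"
  let ?down = "\<lambda>z::real \<times> real. max 0 ((1 + fst z) * snd z - fst z)"
  have up: "continuous_map (prod_topology unit_interval unit_interval) unit_interval ?up"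
    by (auto simp: continuous_map_in_subtopology intro!: continuous_intros)
  have "(1 + r) * t - r \<le> 1" if "0 \<le> r" "t \<le> 1" for r t :: real
  proof -
    have "(1 + r) * t \<le> (1 + r) * 1"
      using that by (intro mult_left_mono) auto
    then show ?thesis
      by simp
  qed
  then have down: "continuous_map (prod_topology unit_interval unit_interval) unit_interval ?down"
    by (auto simp: continuous_map_in_subtopology intro!: continuous_intros)
  have "continuous_map (suspension Y) (top_of_set SO) (\<lambda>p. f (d' p))"
    "continuous_map (suspension Y) (top_of_set SO) (\<lambda>p. h (d' p))"
    using continuous_map_compose_pt[OF d'c] f h by blast+
  note fh = this
  obtain f1 where f1: "homotopic_SO (suspension Y) (\<lambda>p. f (d' p)) f1"
    "\<And>y t. y \<in> topspace Y \<Longrightarrow> t \<in> {0..1} \<Longrightarrow> ?up (1,t) = 1 \<Longrightarrow> f1 (susp_pt Y y t) = mat 1"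
    using suspension_pinch[OF n fh(1) up, of 1] by auto
  obtain h1 where h1: "homotopic_SO (suspension Y) (\<lambda>p. h (d' p)) h1"
    "\<And>y t. y \<in> topspace Y \<Longrightarrow> t \<in> {0..1} \<Longrightarrow> ?down (1,t) = 0 \<Longrightarrow> h1 (susp_pt Y y t) = mat 1"
    using suspension_pinch[OF n fh(2) down, of 0] by auto
  have pull: "homotopic_SO X k (\<lambda>x. k1 (d x))" if "homotopic_SO (suspension Y) (\<lambda>p. k (d' p)) k1"
    for k k1 :: "_ \<Rightarrow> real^'n^'n"
    using homotopic_with_compose_continuous_map_right[OF that dc, of "\<lambda>_. True"]
    by (rule homotopic_SO_cong) (auto simp: d'd)
  have "\<forall>x\<in>topspace X. f1 (d x) = mat 1 \<or> h1 (d x) = mat 1"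
  proof
    fix x
    assume "x \<in> topspace X"
    then have "d x \<in> topspace (suspension Y)"
      using dc by (auto simp: continuous_map_def)
    then obtain y t where yt: "y \<in> topspace Y" "t \<in> {0..1}" "d x = susp_pt Y y t"
      by (rule suspension_cases)
    have "?up (1,t) = 1 \<or> ?down (1,t) = 0"
      by (auto simp: min_def max_def)
    then show "f1 (d x) = mat 1 \<or> h1 (d x) = mat 1"
      using f1(2) h1(2) yt by metis
  qed
  with pull[OF f1(1)] pull[OF h1(1)] show thesis
    by (rule that)
qed

lemma homotopic_SO_mult_commute:
  fixes f h :: "'a \<Rightarrow> real^'n^'n"
  assumes "2 \<le> CARD('n)" "X homeomorphic_space suspension Y"
    "continuous_map X (top_of_set SO) f" "continuous_map X (top_of_set SO) h"
  shows "homotopic_SO X (\<lambda>x. f x ** h x) (\<lambda>x. h x ** f x)"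
proof -
  obtain f' h' where *: "homotopic_SO X f f'" "homotopic_SO X h h'"
    "\<forall>x\<in>topspace X. f' x = mat 1 \<or> h' x = mat 1"
    by (rule suspension_disjoint_supports[OF assms])
  have "homotopic_SO X (\<lambda>x. f x ** h x) (\<lambda>x. f' x ** h' x)"
    by (intro homotopic_SO_mult *)
  moreover have "homotopic_SO X (\<lambda>x. f' x ** h' x) (\<lambda>x. h x ** f x)"
  proof (rule homotopic_SO_cong)
    show "homotopic_SO X (\<lambda>x. h' x ** f' x) (\<lambda>x. h x ** f x)"
      by (intro homotopic_SO_mult *(1,2)[THEN homotopic_with_symD])
  qed (use *(3) in auto)
  ultimately show ?thesis
    by (rule homotopic_with_trans)
qed

lemma comm_group_homotopy_group_SO:
  assumes "2 \<le> CARD('n)" "X homeomorphic_space suspension Y"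
  shows "comm_group (homotopy_group_SO X :: ('a \<Rightarrow> real^'n^'n) set monoid)"
proof (rule group.group_comm_groupI[OF group_homotopy_group_SO], goal_cases)
  case (1 x y)
  then obtain f h where fh: "x = hclass X f" "continuous_map X (top_of_set SO) f"
    "y = hclass X h" "continuous_map X (top_of_set SO) h"
    unfolding carrier_homotopy_group_SO by blast
  then have "hclass X (\<lambda>x. f x ** h x) = hclass X (\<lambda>x. h x ** f x)"
    using hclass_eq_iff[OF continuous_map_SO_mult] homotopic_SO_mult_commute[OF assms] by blast
  then show ?case
    using fh by (simp add: mult_hclass)
qed

section \<open>The turning obstruction\<close>

locale turning_path =
  fixes \<gamma> :: "real \<Rightarrow> real^'n^'n"
  assumes path_\<gamma>: "path \<gamma>" and \<gamma>_image: "path_image \<gamma> \<subseteq> SO"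
    and \<gamma>_start: "pathstart \<gamma> = mat 1" and \<gamma>_finish: "pathfinish \<gamma> = - mat 1"
begin

lemma \<gamma>_0 [simp]: "\<gamma> 0 = mat 1" and \<gamma>_1 [simp]: "\<gamma> 1 = - mat 1"
  using \<gamma>_start \<gamma>_finish by (simp_all add: pathstart_def pathfinish_def)

lemma continuous_map_\<gamma>: "continuous_map unit_interval (top_of_set SO) \<gamma>"
  using path_\<gamma> \<gamma>_image by (auto simp: path_def path_image_def)

text \<open>\<open>\<gamma>\<close> starts and ends in the centre of the rotation group, so conjugation by \<open>g x\<close> does not
  affect the values at the poles.\<close>

lemma TO_map_susp_pt:
  assumes "continuous_map X (top_of_set SO) g" "x \<in> topspace X"
  shows "TO_map \<gamma> g (susp_pt X x t) = g x ** \<gamma> t ** transpose (g x)"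
proof -
  have "constant_on_ends X (\<lambda>(x,t). g x ** \<gamma> t ** matrix_inv (g x))"
    using continuous_map_SO_mem[OF assms(1)] by (simp add: constant_on_ends_def matrix_inv_SO)
  from susp_lift_susp_pt[OF this assms(2)] show ?thesis
    using continuous_map_SO_mem[OF assms] by (simp add: TO_map_def susp_lift_def matrix_inv_SO)
qed

lemma homotopic_TO_map:
  assumes "homotopic_SO X g g'"
  shows "homotopic_SO (suspension X) (TO_map \<gamma> g) (TO_map \<gamma> g')"
proof -
  obtain G where G: "continuous_map (prod_topology unit_interval X) (top_of_set SO) G"
    "\<And>x. G (0,x) = g x" "\<And>x. G (1,x) = g' x"
    using assms unfolding homotopic_with_def by blast
  let ?F = "\<lambda>z. G (fst z, fst (snd z)) ** \<gamma> (snd (snd z)) ** transpose (G (fst z, fst (snd z)))"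
  have G': "G (r,x) \<in> SO" if "r \<in> {0..1}" "x \<in> topspace X" for r x
    using continuous_map_SO_mem[OF G(1)] that by simp
  have c: "constant_on_ends X (\<lambda>q. ?F (r,q))" if "r \<in> {0..1}" for r
    using G'[OF that] by (simp add: constant_on_ends_def)
  show ?thesis
    using homotopic_with_imp_continuous_maps[OF assms]
    by (intro homotopic_suspensionI[of X _ ?F] c continuous_map_SO_intros
        continuous_map_compose_pt[OF _ continuous_map_\<gamma>] continuous_map_compose_pt[OF _ G(1)])
      (simp_all add: TO_map_susp_pt G)
qed

lemma continuous_map_TO_map:
  "continuous_map X (top_of_set SO) g \<Longrightarrow> continuous_map (suspension X) (top_of_set SO) (TO_map \<gamma> g)"
  using homotopic_TO_map[of X g g] homotopic_with_imp_continuous_maps by fastforce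

lemma TO_hclass:
  assumes "continuous_map X (top_of_set SO) g"
  shows "TO X \<gamma> (hclass X g) = hclass (suspension X) (TO_map \<gamma> g)"
proof -
  have *: "hclass (suspension X) (TO_map \<gamma> g') = hclass (suspension X) (TO_map \<gamma> g)"
    if "g' \<in> hclass X g" for g'
    using that unfolding hclass_def[of X]
    by (intro hclass_eq_iff[OF continuous_map_TO_map[OF assms], THEN iffD2, symmetric] homotopic_TO_map) simp
  have "TO X \<gamma> (hclass X g) = (\<Union>g'\<in>hclass X g. hclass (suspension X) (TO_map \<gamma> g))"
    unfolding TO_def by (intro SUP_cong refl *)
  then show ?thesis
    using hclass_self[OF assms] by (auto simp only: UN_constant split: if_splits)
qed

text \<open>\<open>[x,t] \<mapsto> p t\<close> contracts to the constant \<open>p 0\<close> by shrinking the path.\<close>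

lemma homotopic_path_const:
  assumes p: "continuous_map unit_interval (top_of_set SO) p"
  shows "homotopic_SO (suspension X) (susp_lift (\<lambda>(x,t). p t)) (\<lambda>_. p 0)"
proof -
  let ?F = "\<lambda>z. p ((1 - fst z) * snd (snd z))"
  have c: "constant_on_ends X (\<lambda>q. ?F (r,q))" for r :: real
    by (simp add: constant_on_ends_def)
  have "continuous_map (prod_topology unit_interval unit_interval) unit_interval (\<lambda>z. (1 - fst z) * snd z)"
    by (auto simp: mult_le_one intro!: continuous_intros)
  from continuous_map_compose_pt[OF continuous_map_pairedI[OF continuous_map_fst continuous_map_snd_snd] this]
  have "continuous_map (prod_topology unit_interval (prod_topology X unit_interval)) unit_interval
      (\<lambda>z. (1 - fst z) * snd (snd z))"
    by simp
  moreover have "susp_lift (\<lambda>(x,t). p t) (susp_pt X x t) = p t" if "x \<in> topspace X" for x t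
    using susp_lift_susp_pt[of X "\<lambda>(x,t). p t"] that by (simp add: constant_on_ends_def)
  ultimately show ?thesis
    by (intro homotopic_suspensionI[of X _ ?F] c continuous_map_compose_pt[OF _ p]) simp_all
qed

text \<open>If at each point one of \<open>g'\<close>, \<open>h'\<close> is \<open>1\<close>, then the conjugate of \<open>\<gamma> t\<close> by \<open>g' h'\<close> equals
  the product of the conjugates by \<open>g'\<close> and by \<open>h'\<close> with \<open>(\<gamma> t)\<inverse>\<close> inserted between them. The inserted
  factor \<open>[x,t] \<mapsto> (\<gamma> t)\<inverse>\<close> is null-homotopic.\<close>

lemma homotopic_TO_map_mult:
  assumes n: "2 \<le> CARD('n)" and X: "X homeomorphic_space suspension Y"
    and g: "continuous_map X (top_of_set SO) g" and h: "continuous_map X (top_of_set SO) h"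
  shows "homotopic_SO (suspension X) (TO_map \<gamma> (\<lambda>x. g x ** h x)) (\<lambda>p. TO_map \<gamma> g p ** TO_map \<gamma> h p)"
proof -
  obtain g' h' where gh: "homotopic_SO X g g'" "homotopic_SO X h h'"
    "\<forall>x\<in>topspace X. g' x = mat 1 \<or> h' x = mat 1"
    by (rule suspension_disjoint_supports[OF n X g h])
  have g': "continuous_map X (top_of_set SO) g'" and h': "continuous_map X (top_of_set SO) h'"
    using gh homotopic_with_imp_continuous_maps by blast+
  let ?m = "susp_lift (\<lambda>(x,t). transpose (\<gamma> t)) :: ('a \<times> real) set \<Rightarrow> _"
  have "homotopic_SO (suspension X) ?m (\<lambda>_. mat 1)"
    using homotopic_path_const[OF continuous_map_SO_transpose[OF continuous_map_\<gamma>]] by simp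
  then have "homotopic_SO (suspension X)
      (\<lambda>p. TO_map \<gamma> g' p ** ?m p ** TO_map \<gamma> h' p) (\<lambda>p. TO_map \<gamma> g p ** mat 1 ** TO_map \<gamma> h p)"
    using gh by (intro homotopic_SO_mult homotopic_TO_map) (simp_all add: homotopic_with_sym)
  moreover have "TO_map \<gamma> g' p ** ?m p ** TO_map \<gamma> h' p = TO_map \<gamma> (\<lambda>x. g' x ** h' x) p"
    if p: "p \<in> topspace (suspension X)" for p
  proof -
    obtain x t where xt: "x \<in> topspace X" "t \<in> {0..1}" "p = susp_pt X x t"
      using p by (rule suspension_cases)
    have "constant_on_ends X (\<lambda>(x,t). transpose (\<gamma> t))"
      by (simp add: constant_on_ends_def)
    moreover have "\<gamma> t \<in> SO"
      using continuous_map_SO_mem[OF continuous_map_\<gamma>] xt by simp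
    ultimately show ?thesis
      using gh(3) xt g' h'
      by (auto simp: TO_map_susp_pt susp_lift_susp_pt continuous_map_SO_mult matrix_transpose_mul
          simp flip: matrix_mul_assoc)
  qed
  ultimately have "homotopic_SO (suspension X)
      (TO_map \<gamma> (\<lambda>x. g' x ** h' x)) (\<lambda>p. TO_map \<gamma> g p ** TO_map \<gamma> h p)"
    by (rule homotopic_SO_cong) simp_all
  moreover have "homotopic_SO (suspension X) (TO_map \<gamma> (\<lambda>x. g x ** h x)) (TO_map \<gamma> (\<lambda>x. g' x ** h' x))"
    by (intro homotopic_TO_map homotopic_SO_mult gh)
  ultimately show ?thesis
    using homotopic_with_trans by blast
qed

lemma TO_hom:
  fixes X :: "'a topology"
  assumes "2 \<le> CARD('n)" "X homeomorphic_space suspension Y"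
  shows "TO X \<gamma> \<in> hom (homotopy_group_SO X) (homotopy_group_SO (suspension X))"
proof (rule homI, goal_cases)
  case (1 x)
  then show ?case
    by (auto simp: carrier_homotopy_group_SO TO_hclass intro: continuous_map_TO_map)
next
  case (2 x y)
  then obtain g h where gh: "x = hclass X g" "continuous_map X (top_of_set SO) g"
    "y = hclass X h" "continuous_map X (top_of_set SO) h"
    unfolding carrier_homotopy_group_SO by blast
  then have "hclass (suspension X) (TO_map \<gamma> (\<lambda>x. g x ** h x)) =
      hclass (suspension X) (\<lambda>p. TO_map \<gamma> g p ** TO_map \<gamma> h p)"
    using hclass_eq_iff[OF continuous_map_TO_map[OF continuous_map_SO_mult]] homotopic_TO_map_mult[OF assms]
    by blast
  then show ?case
    using gh by (simp add: mult_hclass TO_hclass continuous_map_SO_mult continuous_map_TO_map)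
qed

end

section \<open>Frames of a bundle and matrices of automorphisms\<close>

lemma fibre_iso_mem: "fibre_iso E b f \<Longrightarrow> f v \<in> fibre E b"
  by (auto simp: fibre_iso_def bij_betw_def)

lemma fibre_iso_inj: "fibre_iso E b f \<Longrightarrow> inj f"
  by (simp add: fibre_iso_def bij_betw_def)

lemma fibre_iso_inv [simp]: "fibre_iso E b f \<Longrightarrow> inv_into UNIV f (f v) = v"
  by (simp add: fibre_iso_inj)

lemma fibre_iso_inv_right: "fibre_iso E b f \<Longrightarrow> e \<in> fibre E b \<Longrightarrow> f (inv_into UNIV f e) = e"
  by (auto simp: fibre_iso_def bij_betw_def intro: f_inv_into_f)

lemma oriented_fibre_isometry_iso: "oriented_fibre_isometry E b f \<Longrightarrow> fibre_iso E b f"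
  by (simp add: oriented_fibre_isometry_def)

lemma continuous_map_trivialization:
  assumes "trivialization_on B E A \<phi>" "continuous_map Z (subtopology B A) b" "continuous_map Z euclidean v"
  shows "continuous_map Z (total E) (\<lambda>z. \<phi> (b z) (v z))"
proof -
  have "continuous_map (prod_topology (subtopology B A) euclidean) (total E) (\<lambda>(b,v). \<phi> b v)"
    using assms(1) unfolding trivialization_on_def
    by (blast dest: homeomorphic_imp_continuous_map intro: continuous_map_into_fulltopology)
  from continuous_map_compose_pt[OF continuous_map_pairedI[OF assms(2,3)] this] show ?thesis
    by simp
qed

text \<open>The second component of the inverse of a trivialization gives the coordinates in the frame.\<close>

lemma continuous_map_trivialization_coordinates:
  assumes triv: "trivialization_on B E A \<phi>" and e: "continuous_map Z (total E) e"
    and A: "\<And>z. z \<in> topspace Z \<Longrightarrow> proj E (e z) \<in> A"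
  shows "continuous_map Z euclidean (\<lambda>z. inv_into UNIV (\<phi> (proj E (e z))) (e z))"
proof -
  let ?T = "subtopology (total E) {e \<in> topspace (total E). proj E e \<in> A}"
  obtain \<Psi> where \<Psi>: "homeomorphic_maps (prod_topology (subtopology B A) euclidean) ?T (\<lambda>(b,v). \<phi> b v) \<Psi>"
    using triv unfolding trivialization_on_def homeomorphic_map_maps by blast
  have eq: "inv_into UNIV (\<phi> (proj E e)) e = snd (\<Psi> e)" if e: "e \<in> topspace ?T" for e
  proof -
    have "\<Psi> e \<in> topspace (prod_topology (subtopology B A) euclidean)"
      and "(\<lambda>(b,v). \<phi> b v) (\<Psi> e) = e"
      using \<Psi> e unfolding homeomorphic_maps_def continuous_map_def by blast+
    then obtain b v where bv: "\<Psi> e = (b,v)" "b \<in> A" "\<phi> b v = e"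
      by (cases "\<Psi> e") auto
    have iso: "fibre_iso E b (\<phi> b)"
      using triv bv by (simp add: trivialization_on_def)
    then have "proj E e = b"
      using fibre_iso_mem[OF iso, of v] bv by (simp add: fibre_def)
    then show ?thesis
      using bv fibre_iso_inv[OF iso, of v] by simp
  qed
  have "continuous_map ?T euclidean (\<lambda>e. snd (\<Psi> e))"
    using \<Psi> unfolding homeomorphic_maps_def
    by (blast intro: continuous_map_compose_pt[OF _ continuous_map_snd])
  then have "continuous_map ?T euclidean (\<lambda>e. inv_into UNIV (\<phi> (proj E e)) e)"
    by (rule continuous_map_eq) (simp only: eq)
  moreover have "continuous_map Z ?T e"
  proof -
    have "e z \<in> topspace (total E)" if "z \<in> topspace Z" for z
      using e that by (auto simp: continuous_map_def)
    then show ?thesis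
      using e A by (auto simp: continuous_map_in_subtopology)
  qed
  ultimately show ?thesis
    by (rule continuous_map_compose_pt[rotated])
qed

definition frame_matrix :: "(real^'n \<Rightarrow> 'e) \<Rightarrow> ('e \<Rightarrow> 'e) \<Rightarrow> real^'n^'n" where
  "frame_matrix f a = matrix (\<lambda>v. inv_into UNIV f (a (f v)))"

lemma bundle_automorphism_fibre:
  assumes "bundle_automorphism B E a" "e \<in> fibre E b"
  shows "a e \<in> fibre E b"
proof -
  have "a e \<in> topspace (total E)"
    using assms homeomorphic_imp_surjective_map[of "total E" "total E" a]
    by (auto simp: bundle_automorphism_def fibre_def)
  then show ?thesis
    using assms by (simp add: bundle_automorphism_def fibre_def)
qed

lemma frame_matrix_works:
  assumes a: "bundle_automorphism B E a" and f: "fibre_iso E b f" and b: "b \<in> topspace B"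
  shows "f (frame_matrix f a *v v) = a (f v)"
proof -
  let ?h = "\<lambda>v. inv_into UNIV f (a (f v))"
  have fh: "f (?h v) = a (f v)" for v
    using fibre_iso_inv_right[OF f] bundle_automorphism_fibre[OF a] fibre_iso_mem[OF f] by blast
  have add: "f (u + v) = vadd E (f u) (f v)" and scale: "f (c *\<^sub>R v) = vscale E c (f v)" for u v c
    using f by (simp_all add: fibre_iso_def)
  have "linear ?h"
  proof (rule linearI)
    fix u v
    have "f (?h (u + v)) = a (f (u + v))"
      by (rule fh)
    also have "\<dots> = a (vadd E (f u) (f v))"
      by (simp only: add)
    also have "\<dots> = vadd E (a (f u)) (a (f v))"
      using a b fibre_iso_mem[OF f] by (auto simp: bundle_automorphism_def)
    also have "\<dots> = f (?h u + ?h v)"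
      by (simp only: add fh)
    finally show "?h (u + v) = ?h u + ?h v"
      using fibre_iso_inj[OF f] by (simp only: inj_eq)
  next
    fix c v
    have "f (?h (c *\<^sub>R v)) = a (f (c *\<^sub>R v))"
      by (rule fh)
    also have "\<dots> = a (vscale E c (f v))"
      by (simp only: scale)
    also have "\<dots> = vscale E c (a (f v))"
      using a b fibre_iso_mem[OF f] unfolding bundle_automorphism_def by blast
    also have "\<dots> = f (c *\<^sub>R ?h v)"
      by (simp only: fh scale)
    finally show "?h (c *\<^sub>R v) = c *\<^sub>R ?h v"
      using fibre_iso_inj[OF f] by (simp only: inj_eq)
  qed
  then have "frame_matrix f a *v v = ?h v"
    unfolding frame_matrix_def by (simp add: matrix_works linear_matrix_vector_mul_eq)
  then show ?thesis
    by (simp add: fh)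
qed

lemma frame_matrix_eqI:
  assumes f: "fibre_iso E b f" and "\<And>v. a (f v) = f (M *v v)"
  shows "frame_matrix f a = M"
  using assms by (simp add: frame_matrix_def)

lemma continuous_map_vec:
  fixes h :: "'z \<Rightarrow> 'i::finite \<Rightarrow> 'c::topological_space"
  assumes "\<And>i. continuous_map Z euclidean (\<lambda>z. h z i)"
  shows "continuous_map Z euclidean (\<lambda>z. \<chi> i. h z i)"
  using assms unfolding continuous_map_atin limitin_canonical_iff by (auto intro: tendsto_vec_lambda)

text \<open>The columns of the matrix are the coordinates of the images of the frame vectors, which depend
  continuously on the time and on the base point.\<close>

lemma continuous_map_frame_matrix:
  assumes triv: "trivialization_on B E A \<phi>" and \<alpha>: "turning B E \<alpha>"
  shows "continuous_map (prod_topology unit_interval (subtopology B A)) euclidean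
    (\<lambda>z. frame_matrix (\<phi> (snd z)) (\<alpha> (fst z)))"
proof -
  let ?Z = "prod_topology unit_interval (subtopology B A)"
  let ?e = "\<lambda>j z. \<alpha> (fst z) (\<phi> (snd z) (axis j 1))"
  have "continuous_map ?Z (prod_topology unit_interval (total E)) (\<lambda>z. (fst z, \<phi> (snd z) (axis j 1)))" for j
    by (intro continuous_map_pairedI continuous_map_fst continuous_map_trivialization[OF triv]
        continuous_map_snd) simp
  then have cont: "continuous_map ?Z (total E) (?e j)" for j
    using continuous_map_compose_pt[of ?Z _ _ "total E" "\<lambda>(t,e). \<alpha> t e"] \<alpha>
    by (fastforce simp: turning_def)
  have proj: "proj E (?e j z) = snd z" if z: "z \<in> topspace ?Z" for j z
  proof -
    have "bundle_automorphism B E (\<alpha> (fst z))"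
      using \<alpha> z by (auto simp: turning_def)
    moreover have "fibre_iso E (snd z) (\<phi> (snd z))"
      using triv z by (auto simp: trivialization_on_def)
    ultimately have "?e j z \<in> fibre E (snd z)"
      by (rule bundle_automorphism_fibre[OF _ fibre_iso_mem])
    then show ?thesis
      by (simp add: fibre_def)
  qed
  have "continuous_map ?Z euclidean (\<lambda>z. inv_into UNIV (\<phi> (proj E (?e j z))) (?e j z))" for j
    by (rule continuous_map_trivialization_coordinates[OF triv cont]) (auto simp: proj)
  then have col: "continuous_map ?Z euclidean (\<lambda>z. inv_into UNIV (\<phi> (snd z)) (?e j z))" for j
    by (rule continuous_map_eq) (simp add: proj)
  have comp: "continuous_map euclidean euclidean (\<lambda>v::real^'c. v $ i)" for i
    unfolding continuous_map_iff_continuous2 by (intro continuous_on_component continuous_on_id)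
  show ?thesis
    unfolding frame_matrix_def matrix_def
    by (intro continuous_map_vec) (rule continuous_map_compose_pt[OF col comp])
qed

text \<open>Positive isometric frames of a fibre differ by an isometry of \<open>\<real>\<^sup>n\<close>; its determinant is
  positive because both frames lie in the same orientation class.\<close>

lemma frame_change:
  fixes E :: "('b, 'e, 'n::finite) vbundle"
  assumes ori: "orientation_structure B E" and b: "b \<in> topspace B"
    and f: "oriented_fibre_isometry E b f" and f': "oriented_fibre_isometry E b f'"
  obtains C where "C \<in> SO" "\<And>v. f' v = f (C *v v)"
proof -
  obtain f0 where f0: "fibre_iso E b f0" "ori E b = {(\<lambda>v. f0 (A *v v)) | A :: real^'n^'n. det A > 0}"
    using ori b unfolding orientation_structure_def by blast
  obtain A A' where A: "f = (\<lambda>v. f0 (A *v v))" "det A > 0" and A': "f' = (\<lambda>v. f0 (A' *v v))" "det A' > 0"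
    using f f' f0 unfolding oriented_fibre_isometry_def by auto
  obtain AI where AI: "A ** AI = mat 1"
    using A invertible_det_nz[of A] by (auto simp: invertible_def)
  define C where "C = AI ** A'"
  have C: "f' v = f (C *v v)" for v
    by (simp add: A A' C_def matrix_vector_mul_assoc matrix_mul_assoc AI)
  have "(C *v u) \<bullet> (C *v v) = u \<bullet> v" for u v
    using f f' C by (metis oriented_fibre_isometry_def)
  then have "orthogonal_matrix C"
    using orthogonal_transformation_matrix[of "(*v) C"] by (simp add: orthogonal_transformation_def)
  moreover have "det A * det AI = 1"
    using arg_cong[OF AI, of det] by (simp add: det_mul)
  then have "det AI > 0"
    using zero_less_mult_pos[of "det A" "det AI"] A(2) by simp
  then have "det C > 0"
    using A'(2) by (simp add: C_def det_mul)
  ultimately have "C \<in> SO"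
    using det_orthogonal_matrix[of C] by (auto simp: SO_def rotation_matrix_def)
  then show thesis
    using C that by blast
qed

lemma frame_matrix_change:
  assumes a: "bundle_automorphism B E a" and b: "b \<in> topspace B"
    and f: "fibre_iso E b f" and f': "fibre_iso E b f'"
    and C: "C \<in> SO" "\<And>v. f' v = f (C *v v)"
  shows "frame_matrix f' a = transpose C ** frame_matrix f a ** C"
proof (rule frame_matrix_eqI[OF f'])
  fix v
  have "f' ((transpose C ** frame_matrix f a ** C) *v v) = f (frame_matrix f a *v (C *v v))"
    using C by (simp add: C(2) matrix_vector_mul_assoc del: transpose_matrix_vector flip: matrix_mul_assoc)
  then show "a (f' v) = f' ((transpose C ** frame_matrix f a ** C) *v v)"
    by (simp add: frame_matrix_works[OF a f b] C(2))
qed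

section \<open>Bundles glued over the two cones\<close>

definition susp_height :: "('a \<times> real) set \<Rightarrow> real" where
  "susp_height = susp_lift snd"

lemma susp_height_susp_pt [simp]: "x \<in> topspace X \<Longrightarrow> susp_height (susp_pt X x t) = t"
  by (simp add: susp_height_def susp_lift_susp_pt constant_on_ends_def)

lemma continuous_map_susp_height: "continuous_map (suspension X) euclideanreal susp_height"
proof (rule continuous_compose_quotient_map[OF quotient_map_suspension])
  have "continuous_map (prod_topology X unit_interval) euclideanreal snd"
    using continuous_map_snd continuous_map_into_fulltopology by blast
  then show "continuous_map (prod_topology X unit_interval) euclideanreal (susp_height \<circ> (\<lambda>(x,t). susp_pt X x t))"
    by (rule continuous_map_eq) auto
qed

lemma lower_cone_iff: "p \<in> lower_cone X \<longleftrightarrow> p \<in> topspace (suspension X) \<and> susp_height p \<le> 1/2"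
proof
  assume "p \<in> lower_cone X"
  then show "p \<in> topspace (suspension X) \<and> susp_height p \<le> 1/2"
    unfolding lower_cone_def by auto
next
  assume p: "p \<in> topspace (suspension X) \<and> susp_height p \<le> 1/2"
  then obtain x t where "x \<in> topspace X" "t \<in> {0..1}" "p = susp_pt X x t"
    using suspension_cases by blast
  then show "p \<in> lower_cone X"
    using p unfolding lower_cone_def by auto
qed

lemma upper_cone_iff: "p \<in> upper_cone X \<longleftrightarrow> p \<in> topspace (suspension X) \<and> 1/2 \<le> susp_height p"
proof
  assume "p \<in> upper_cone X"
  then show "p \<in> topspace (suspension X) \<and> 1/2 \<le> susp_height p"
    unfolding upper_cone_def by auto
next
  assume p: "p \<in> topspace (suspension X) \<and> 1/2 \<le> susp_height p"
  then obtain x t where "x \<in> topspace X" "t \<in> {0..1}" "p = susp_pt X x t"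
    using suspension_cases by blast
  then show "p \<in> upper_cone X"
    using p unfolding upper_cone_def by auto
qed

text \<open>The data of a clutching function, with the two trivializations fixed.\<close>

locale clutched_bundle =
  fixes X :: "'a topology" and E :: "(('a \<times> real) set, 'e, 'n::finite) vbundle"
    and g :: "'a \<Rightarrow> real^'n^'n" and \<phi> :: "('a \<times> real) set \<Rightarrow> real^'n \<Rightarrow> 'e"
    and \<psi> :: "('a \<times> real) set \<Rightarrow> real^'n \<Rightarrow> 'e"
  assumes oriented_bundle: "oriented_euclidean_bundle (suspension X) E"
    and g: "continuous_map X (top_of_set SO) g"
    and \<phi>: "trivialization_on (suspension X) E (lower_cone X) \<phi>"
    and \<phi>_isometry: "\<And>b. b \<in> lower_cone X \<Longrightarrow> oriented_fibre_isometry E b (\<phi> b)"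
    and \<psi>: "trivialization_on (suspension X) E (upper_cone X) \<psi>"
    and \<psi>_isometry: "\<And>b. b \<in> upper_cone X \<Longrightarrow> oriented_fibre_isometry E b (\<psi> b)"
    and clutch: "\<And>x v. x \<in> topspace X \<Longrightarrow> \<phi> (susp_pt X x (1/2)) v = \<psi> (susp_pt X x (1/2)) (g x *v v)"
begin

abbreviation S :: "('a \<times> real) set topology" where "S \<equiv> suspension X"

lemma proj_continuous: "continuous_map (total E) S (proj E)"
  using oriented_bundle by (simp add: oriented_euclidean_bundle_def vector_bundle_def)

lemma orientation: "orientation_structure S E"
  using oriented_bundle by (simp add: oriented_euclidean_bundle_def)

lemma proj_mem: "e \<in> topspace (total E) \<Longrightarrow> proj E e \<in> topspace S"
  using proj_continuous by (auto simp: continuous_map_def)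

lemma cones_cover: "b \<in> topspace S \<Longrightarrow> b \<in> lower_cone X \<or> b \<in> upper_cone X"
  by (auto simp: lower_cone_iff upper_cone_iff)

lemma cones_Int: 
  assumes "b \<in> topspace S" "susp_height b = 1/2"
  obtains x where "x \<in> topspace X" "b = susp_pt X x (1/2)"
proof -
  obtain x t where x: "x \<in> topspace X" "b = susp_pt X x t"
    using assms(1) by (rule suspension_cases)
  then have "t = 1/2"
    using assms(2) by simp
  with x that show thesis
    by blast
qed

text \<open>The fibrewise linear map with matrix \<open>M b\<close> over the lower and \<open>N b\<close> over the upper cone. Over the
  equator the definition prefers \<open>M\<close>; this is immaterial when the matrices are conjugate by \<open>g\<close> there,
  which is the condition \<open>glueable\<close>.\<close>

definition glue :: "(('a \<times> real) set \<Rightarrow> real^'n^'n) \<Rightarrow> (('a \<times> real) set \<Rightarrow> real^'n^'n) \<Rightarrow> 'e \<Rightarrow> 'e" where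
  "glue M N e = (let b = proj E e in
     if susp_height b \<le> 1/2 then \<phi> b (M b *v inv_into UNIV (\<phi> b) e)
     else \<psi> b (N b *v inv_into UNIV (\<psi> b) e))"

definition glueable :: "(('a \<times> real) set \<Rightarrow> real^'n^'n) \<Rightarrow> (('a \<times> real) set \<Rightarrow> real^'n^'n) \<Rightarrow> bool" where
  "glueable M N \<longleftrightarrow> (\<forall>x\<in>topspace X. N (susp_pt X x (1/2)) ** g x = g x ** M (susp_pt X x (1/2)))"

lemma \<phi>_iso: "b \<in> lower_cone X \<Longrightarrow> fibre_iso E b (\<phi> b)"
  and \<psi>_iso: "b \<in> upper_cone X \<Longrightarrow> fibre_iso E b (\<psi> b)"
  by (simp_all add: oriented_fibre_isometry_iso \<phi>_isometry \<psi>_isometry)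

lemma glue_lower:
  assumes "b \<in> lower_cone X"
  shows "glue M N (\<phi> b v) = \<phi> b (M b *v v)"
proof -
  have "proj E (\<phi> b v) = b"
    using fibre_iso_mem[OF \<phi>_iso[OF assms], of v] by (simp add: fibre_def)
  then show ?thesis
    using assms fibre_iso_inv[OF \<phi>_iso[OF assms]] by (simp add: glue_def lower_cone_iff)
qed

lemma glue_upper:
  assumes MN: "glueable M N" and b: "b \<in> upper_cone X"
  shows "glue M N (\<psi> b v) = \<psi> b (N b *v v)"
proof (cases "susp_height b \<le> 1/2")
  case True
  then obtain x where x: "x \<in> topspace X" "b = susp_pt X x (1/2)"
    using b cones_Int[of b] by (auto simp: upper_cone_iff)
  have bl: "b \<in> lower_cone X"
    using b True by (auto simp: lower_cone_iff upper_cone_iff)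
  have gx: "g x \<in> SO"
    using continuous_map_SO_mem[OF g x(1)] .
  have "v = g x *v (transpose (g x) *v v)"
    using gx by (simp add: matrix_vector_mul_assoc del: transpose_matrix_vector)
  then have v: "\<psi> b v = \<phi> b (transpose (g x) *v v)"
    using clutch[OF x(1)] x(2) by metis
  have "glue M N (\<psi> b v) = \<psi> b ((g x ** M b ** transpose (g x)) *v v)"
    unfolding v glue_lower[OF bl] using clutch[OF x(1)] x(2)
    by (simp add: matrix_vector_mul_assoc matrix_mul_assoc del: transpose_matrix_vector)
  also have "g x ** M b ** transpose (g x) = N b ** g x ** transpose (g x)"
    using MN x by (simp add: glueable_def)
  also have "\<dots> = N b"
    using gx by (simp flip: matrix_mul_assoc)
  finally show ?thesis .
next
  case False
  have "proj E (\<psi> b v) = b"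
    using fibre_iso_mem[OF \<psi>_iso[OF b], of v] by (simp add: fibre_def)
  then show ?thesis
    using False fibre_iso_inv[OF \<psi>_iso[OF b]] by (simp add: glue_def)
qed

lemma bundle_cases:
  assumes "e \<in> topspace (total E)"
  obtains b v where "b \<in> lower_cone X" "e = \<phi> b v" "proj E e = b"
  | b v where "b \<in> upper_cone X" "e = \<psi> b v" "proj E e = b"
proof -
  have e: "e \<in> fibre E (proj E e)"
    using assms by (simp add: fibre_def)
  show thesis
    using cones_cover[OF proj_mem[OF assms]] that
      fibre_iso_inv_right[OF \<phi>_iso e] fibre_iso_inv_right[OF \<psi>_iso e] by metis
qed

text \<open>Both formulas are continuous over the closed cones and agree over the equator.\<close>

lemma continuous_map_glue:
  assumes M: "continuous_map (prod_topology Z (subtopology S (lower_cone X))) euclidean (\<lambda>(z,b). M z b)"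
    and N: "continuous_map (prod_topology Z (subtopology S (upper_cone X))) euclidean (\<lambda>(z,b). N z b)"
    and MN: "\<And>z. z \<in> topspace Z \<Longrightarrow> glueable (M z) (N z)"
  shows "continuous_map (prod_topology Z (total E)) (total E) (\<lambda>(z,e). glue (M z) (N z) e)"
proof -
  let ?W = "prod_topology Z (total E)"
  let ?h = "\<lambda>w. susp_height (proj E (snd w))"
  have act: "continuous_map (subtopology ?W C) (total E)
      (\<lambda>w. \<theta> (proj E (snd w)) (K (fst w) (proj E (snd w)) *v inv_into UNIV (\<theta> (proj E (snd w))) (snd w)))"
    if K: "continuous_map (prod_topology Z (subtopology S A)) euclidean (\<lambda>(z,b). K z b)"
      and \<theta>: "trivialization_on S E A \<theta>" and C: "\<And>w. w \<in> topspace ?W \<Longrightarrow> w \<in> C \<Longrightarrow> proj E (snd w) \<in> A"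
    for K A C and \<theta> :: "_ \<Rightarrow> real^'n \<Rightarrow> 'e"
  proof -
    let ?WC = "subtopology ?W C"
    have z: "continuous_map ?WC Z fst" and e: "continuous_map ?WC (total E) snd"
      by (simp_all add: continuous_map_from_subtopology continuous_map_fst continuous_map_snd)
    have b: "continuous_map ?WC (subtopology S A) (\<lambda>w. proj E (snd w))"
      using C by (auto simp: continuous_map_in_subtopology intro: continuous_map_compose_pt[OF e proj_continuous])
    have Kc: "continuous_map ?WC euclidean (\<lambda>w. K (fst w) (proj E (snd w)))"
      using continuous_map_compose_pt[OF continuous_map_pairedI[OF z b] K] by simp
    have v: "continuous_map ?WC euclidean (\<lambda>w. inv_into UNIV (\<theta> (proj E (snd w))) (snd w))"
      using C by (intro continuous_map_trivialization_coordinates[OF \<theta> e]) auto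
    have "continuous_map (prod_topology euclidean euclidean) euclidean (\<lambda>p :: (real^'n^'n) \<times> (real^'n). fst p *v snd p)"
      unfolding matrix_vector_mult_def
      by (intro continuous_map_vec) (auto intro!: continuous_intros continuous_on_component)
    from continuous_map_compose_pt[OF continuous_map_pairedI[OF Kc v] this]
    show ?thesis
      by (intro continuous_map_trivialization[OF \<theta> b]) simp
  qed
  have "continuous_map ?W (total E) (\<lambda>w. if ?h w \<le> 1/2
      then \<phi> (proj E (snd w)) (M (fst w) (proj E (snd w)) *v inv_into UNIV (\<phi> (proj E (snd w))) (snd w))
      else \<psi> (proj E (snd w)) (N (fst w) (proj E (snd w)) *v inv_into UNIV (\<psi> (proj E (snd w))) (snd w)))"
  proof (rule continuous_map_cases_le)
    show "continuous_map ?W euclideanreal ?h"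
      by (rule continuous_map_compose_pt[OF continuous_map_compose_pt[OF continuous_map_snd proj_continuous]
            continuous_map_susp_height])
  next
    fix w
    assume w: "w \<in> topspace ?W" "?h w = 1/2"
    then have b: "proj E (snd w) \<in> lower_cone X" "proj E (snd w) \<in> upper_cone X"
      using proj_mem by (auto simp: lower_cone_iff upper_cone_iff)
    let ?b = "proj E (snd w)"
    have e: "snd w \<in> fibre E ?b"
      using w by (auto simp: fibre_def)
    have "\<phi> ?b (M (fst w) ?b *v inv_into UNIV (\<phi> ?b) (snd w)) = glue (M (fst w)) (N (fst w)) (snd w)"
      using glue_lower[OF b(1)] fibre_iso_inv_right[OF \<phi>_iso[OF b(1)] e] by metis
    also have "\<dots> = \<psi> ?b (N (fst w) ?b *v inv_into UNIV (\<psi> ?b) (snd w))"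
      using glue_upper[OF MN b(2)] fibre_iso_inv_right[OF \<psi>_iso[OF b(2)] e] w
      by (metis mem_Times_iff topspace_prod_topology)
    finally show "\<phi> ?b (M (fst w) ?b *v inv_into UNIV (\<phi> ?b) (snd w)) =
      \<psi> ?b (N (fst w) ?b *v inv_into UNIV (\<psi> ?b) (snd w))" .
  qed (use proj_mem in \<open>auto intro!: act[OF M \<phi>] act[OF N \<psi>] simp: lower_cone_iff upper_cone_iff\<close>)
  then show ?thesis
    by (simp add: glue_def Let_def case_prod_unfold)
qed

lemma glue_fibre:
  assumes MN: "glueable M N" and e: "e \<in> topspace (total E)"
  shows "glue M N e \<in> fibre E (proj E e)"
  using e
proof (cases rule: bundle_cases)
  case (1 b v)
  then show ?thesis
    using fibre_iso_mem[OF \<phi>_iso] by (auto simp: glue_lower)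
next
  case (2 b v)
  then show ?thesis
    using fibre_iso_mem[OF \<psi>_iso] by (auto simp: glue_upper[OF MN])
qed

lemma glue_inverse:
  assumes "glueable M N" "glueable M' N'" "e \<in> topspace (total E)"
    and "\<And>b. b \<in> lower_cone X \<Longrightarrow> M' b ** M b = mat 1" "\<And>b. b \<in> upper_cone X \<Longrightarrow> N' b ** N b = mat 1"
  shows "glue M' N' (glue M N e) = e"
  using assms(3)
  by (cases rule: bundle_cases)
    (simp_all add: glue_lower glue_upper assms matrix_vector_mul_assoc)

lemma glueable_transpose:
  assumes MN: "glueable M N"
    and M: "\<And>b. b \<in> lower_cone X \<Longrightarrow> M b \<in> SO" and N: "\<And>b. b \<in> upper_cone X \<Longrightarrow> N b \<in> SO"
  shows "glueable (\<lambda>b. transpose (M b)) (\<lambda>b. transpose (N b))"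
  unfolding glueable_def
proof
  fix x
  assume x: "x \<in> topspace X"
  let ?b = "susp_pt X x (1/2)"
  have b: "?b \<in> lower_cone X" "?b \<in> upper_cone X"
    using x by (simp_all add: lower_cone_iff upper_cone_iff)
  have "N ?b = g x ** M ?b ** transpose (g x)"
    using MN x continuous_map_SO_mem[OF g x] unfolding glueable_def
    by (metis SO_transpose_mult(2) matrix_mul_assoc matrix_mul_rid)
  then show "transpose (N ?b) ** g x = g x ** transpose (M ?b)"
    using continuous_map_SO_mem[OF g x] by (simp add: matrix_transpose_mul flip: matrix_mul_assoc)
qed

lemma glue_linear_isometric:
  assumes MN: "glueable M N" and b: "b \<in> topspace S" and x: "x \<in> fibre E b" and y: "y \<in> fibre E b"
    and M: "\<And>b. b \<in> lower_cone X \<Longrightarrow> M b \<in> SO" and N: "\<And>b. b \<in> upper_cone X \<Longrightarrow> N b \<in> SO"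
  shows "glue M N (vadd E x y) = vadd E (glue M N x) (glue M N y)"
    "glue M N (vscale E c x) = vscale E c (glue M N x)"
    "ip E (glue M N x) (glue M N y) = ip E x y"
proof -
  obtain f K where f: "oriented_fibre_isometry E b f" and K: "K \<in> SO"
    and fK: "\<And>v. glue M N (f v) = f (K *v v)"
    using cones_cover[OF b] \<phi>_isometry \<psi>_isometry glue_lower glue_upper[OF MN] M N by metis
  obtain u v where uv: "x = f u" "y = f v"
    using x y fibre_iso_inv_right[OF oriented_fibre_isometry_iso[OF f]] by metis
  have add: "vadd E (f u) (f v) = f (u + v)" and scale: "vscale E c (f v) = f (c *\<^sub>R v)"
    and ip: "ip E (f u) (f v) = u \<bullet> v" for u v c
    using f by (simp_all add: oriented_fibre_isometry_def fibre_iso_def)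
  show "glue M N (vadd E x y) = vadd E (glue M N x) (glue M N y)"
    by (simp add: uv add fK matrix_vector_right_distrib)
  show "glue M N (vscale E c x) = vscale E c (glue M N x)"
    by (simp add: uv scale fK matrix_vector_mult_scaleR)
  show "ip E (glue M N x) (glue M N y) = ip E x y"
    using K by (simp add: uv ip fK orthogonal_matrix_inner SO_def rotation_matrix_def)
qed

text \<open>Each \<open>glue (M t) (N t)\<close> is invertible because the transposed matrices can be glued as well; their
  gluing is the inverse.\<close>

lemma turning_glue:
  assumes M: "continuous_map (prod_topology unit_interval (subtopology S (lower_cone X))) (top_of_set SO) (\<lambda>(t,b). M t b)"
    and N: "continuous_map (prod_topology unit_interval (subtopology S (upper_cone X))) (top_of_set SO) (\<lambda>(t,b). N t b)"
    and MN: "\<And>t. t \<in> {0..1} \<Longrightarrow> glueable (M t) (N t)"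
    and M_ends: "\<And>b. b \<in> lower_cone X \<Longrightarrow> M 0 b = mat 1 \<and> M 1 b = - mat 1"
    and N_ends: "\<And>b. b \<in> upper_cone X \<Longrightarrow> N 0 b = mat 1 \<and> N 1 b = - mat 1"
  shows "turning S E (\<lambda>t. glue (M t) (N t))"
proof -
  let ?M' = "\<lambda>t b. transpose (M t b)" and ?N' = "\<lambda>t b. transpose (N t b)"
  have MSO: "M t b \<in> SO" if "t \<in> {0..1}" "b \<in> lower_cone X" for t b
    using continuous_map_SO_mem[OF M, of "(t,b)"] that by (simp add: lower_cone_iff)
  have NSO: "N t b \<in> SO" if "t \<in> {0..1}" "b \<in> upper_cone X" for t b
    using continuous_map_SO_mem[OF N, of "(t,b)"] that by (simp add: upper_cone_iff)
  have MN': "glueable (?M' t) (?N' t)" if "t \<in> {0..1}" for t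
    using glueable_transpose[OF MN[OF that]] MSO NSO that by blast
  have cont: "continuous_map (prod_topology unit_interval (total E)) (total E) (\<lambda>(t,e). glue (M t) (N t) e)"
    using M N MN by (intro continuous_map_glue) (auto simp: continuous_map_SO_iff)
  have cont': "continuous_map (prod_topology unit_interval (total E)) (total E) (\<lambda>(t,e). glue (?M' t) (?N' t) e)"
    using continuous_map_SO_transpose[OF M] continuous_map_SO_transpose[OF N] MN'
    by (intro continuous_map_glue) (auto simp: continuous_map_SO_iff case_prod_unfold)
  have "bundle_automorphism S E (glue (M t) (N t))" if t: "t \<in> {0..1}" for t
  proof -
    have pair: "continuous_map (total E) (prod_topology unit_interval (total E)) (\<lambda>e. (t,e))"
      using t by (intro continuous_map_pairedI) auto
    have "homeomorphic_maps (total E) (total E) (glue (M t) (N t)) (glue (?M' t) (?N' t))"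
      unfolding homeomorphic_maps_def
    proof (intro conjI ballI)
      show "continuous_map (total E) (total E) (glue (M t) (N t))"
        using continuous_map_compose_pt[OF pair cont] by simp
      show "continuous_map (total E) (total E) (glue (?M' t) (?N' t))"
        using continuous_map_compose_pt[OF pair cont'] by simp
      show "glue (?M' t) (?N' t) (glue (M t) (N t) e) = e" if "e \<in> topspace (total E)" for e
        using MSO NSO t by (intro glue_inverse MN MN' that) auto
      show "glue (M t) (N t) (glue (?M' t) (?N' t) e) = e" if "e \<in> topspace (total E)" for e
        using MSO NSO t by (intro glue_inverse MN MN' that) auto
    qed
    moreover have "proj E (glue (M t) (N t) e) = proj E e" if "e \<in> topspace (total E)" for e
      using glue_fibre[OF MN[OF t] that] by (simp add: fibre_def)
    ultimately show ?thesis
      unfolding bundle_automorphism_def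
      using glue_linear_isometric[OF MN[OF t]] MSO[OF t] NSO[OF t] homeomorphic_maps_map by blast
  qed
  moreover have "glue (M 0) (N 0) e = e \<and> glue (M 1) (N 1) e = vscale E (-1) e"
    if "e \<in> topspace (total E)" for e
    using that
  proof (cases rule: bundle_cases)
    case (1 b v)
    have "vscale E (-1) (\<phi> b v) = \<phi> b (- v)"
      using \<phi>_iso[OF 1(1)] by (metis fibre_iso_def scaleR_minus1_left)
    then show ?thesis
      using 1 M_ends by (simp add: glue_lower minus_matrix_vector_mult)
  next
    case (2 b v)
    have "vscale E (-1) (\<psi> b v) = \<psi> b (- v)"
      using \<psi>_iso[OF 2(1)] by (metis fibre_iso_def scaleR_minus1_left)
    then show ?thesis
      using 2 N_ends MN by (simp add: glue_upper minus_matrix_vector_mult)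
  qed
  ultimately show ?thesis
    using cont by (simp add: turning_def)
qed

end

section \<open>Turnings and null-homotopies of the obstruction\<close>

text \<open>In the following, a family of paths in the rotation group from \<open>1\<close> to \<open>-1\<close> is given by its value
  \<open>H (t,(x,r))\<close>, where \<open>t\<close> is the time of the paths, \<open>x\<close> is a point of \<open>X\<close> and \<open>r\<close> is a deformation
  parameter.\<close>

locale clutched_bundle_turning_path = clutched_bundle X E g \<phi> \<psi> + turning_path \<gamma>
  for X :: "'a topology" and E :: "(('a \<times> real) set, 'e, 'n::finite) vbundle" and g \<phi> \<psi>
    and \<gamma> :: "real \<Rightarrow> real^'n^'n" +
  assumes dim: "2 \<le> CARD('n)"
begin

lemma \<gamma>_SO: "t \<in> {0..1} \<Longrightarrow> \<gamma> t \<in> SO"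
  using \<gamma>_image by (auto simp: path_image_def)

lemma g_SO: "x \<in> topspace X \<Longrightarrow> g x \<in> SO"
  by (rule continuous_map_SO_mem[OF g])

text \<open>The turning is \<open>\<gamma>\<close> over the whole lower cone. Over the upper cone it runs through the deformation
  from the conjugate of \<open>\<gamma>\<close>, which matches \<open>\<gamma>\<close> over the equator, back to \<open>\<gamma>\<close> itself, which is
  independent of \<open>x\<close> and therefore extends over the apex. The remaining part of the deformation is a path
  homotopy from the turning in each fibre to \<open>\<gamma>\<close>.\<close>

lemma gamma_turnable_if_homotopy:
  assumes H: "continuous_map (prod_topology unit_interval (prod_topology X unit_interval)) (top_of_set SO) H"
    and H0: "\<And>t x. t \<in> {0..1} \<Longrightarrow> x \<in> topspace X \<Longrightarrow> H (t,(x,0)) = g x ** \<gamma> t ** transpose (g x)"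
    and H1: "\<And>t x. t \<in> {0..1} \<Longrightarrow> x \<in> topspace X \<Longrightarrow> H (t,(x,1)) = \<gamma> t"
    and ends: "\<And>x r. x \<in> topspace X \<Longrightarrow> r \<in> {0..1} \<Longrightarrow> H (0,(x,r)) = mat 1 \<and> H (1,(x,r)) = - mat 1"
  shows "gamma_turnable S E \<gamma>"
proof -
  define M where "M t b = \<gamma> t" for t and b :: "('a \<times> real) set"
  \<comment> \<open>On the upper cone, where the height \<open>s\<close> is at least \<open>1/2\<close>, the deformation parameter is \<open>2 * s - 1\<close>.
     The absolute value extends the formula to the whole suspension with value \<open>\<gamma>\<close> at both poles.\<close>
  define F where "F = (\<lambda>z. H (fst z, (fst (snd z), \<bar>2 * snd (snd z) - 1\<bar>)))"
  define N where "N t = susp_lift (\<lambda>q. F (t,q))" for t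
  have F_ends: "constant_on_ends X (\<lambda>q. F (t,q))" if "t \<in> {0..1}" for t
    using H1[OF that] by (simp add: F_def constant_on_ends_def)
  have N_pt: "N t (susp_pt X x s) = H (t, (x, \<bar>2 * s - 1\<bar>))" if "t \<in> {0..1}" "x \<in> topspace X" for t x s
    using susp_lift_susp_pt[OF F_ends[OF that(1)] that(2)] by (simp add: N_def F_def)
  have "continuous_map unit_interval unit_interval (\<lambda>s. \<bar>2 * s - 1\<bar>)"
    by (auto intro!: continuous_intros)
  from continuous_map_compose_pt[OF continuous_map_snd_snd this]
  have "continuous_map (prod_topology unit_interval (prod_topology X unit_interval)) (top_of_set SO) F"
    unfolding F_def
    by (intro continuous_map_compose_pt[OF _ H] continuous_map_pairedI continuous_map_fst continuous_map_fst_snd)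
  from continuous_map_susp_lift[OF this F_ends]
  have "continuous_map (prod_topology unit_interval S) (top_of_set SO) (\<lambda>(t,b). N t b)"
    by (simp add: N_def)
  then have N: "continuous_map (prod_topology unit_interval (subtopology S (upper_cone X))) (top_of_set SO) (\<lambda>(t,b). N t b)"
    unfolding prod_topology_subtopology by (rule continuous_map_from_subtopology)
  have M: "continuous_map (prod_topology unit_interval (subtopology S (lower_cone X))) (top_of_set SO) (\<lambda>(t,b). M t b)"
    unfolding M_def case_prod_unfold by (rule continuous_map_compose_pt[OF continuous_map_fst continuous_map_\<gamma>])
  have MN: "glueable (M t) (N t)" if t: "t \<in> {0..1}" for t
    unfolding glueable_def
  proof
    fix x
    assume x: "x \<in> topspace X"
    then show "N t (susp_pt X x (1/2)) ** g x = g x ** M t (susp_pt X x (1/2))"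
      using g_SO[OF x] t by (simp add: N_pt H0 M_def flip: matrix_mul_assoc)
  qed
  let ?\<alpha> = "\<lambda>t. glue (M t) (N t)"
  have "N 0 b = mat 1 \<and> N 1 b = - mat 1" if b: "b \<in> upper_cone X" for b
  proof -
    obtain x s where xs: "x \<in> topspace X" "1/2 \<le> s" "s \<le> 1" "b = susp_pt X x s"
      using b unfolding upper_cone_def by blast
    then show ?thesis
      using ends[of x "\<bar>2 * s - 1\<bar>"] by (simp add: N_pt)
  qed
  then have turning: "turning S E ?\<alpha>"
    using M N MN by (intro turning_glue) (auto simp: M_def)
  moreover have "\<exists>f. oriented_fibre_isometry E b f \<and> homotopic_paths SO (\<lambda>t. frame_matrix f (?\<alpha> t)) \<gamma>"
    if b: "b \<in> topspace S" for b
    using cones_cover[OF b]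
  proof
    assume b: "b \<in> lower_cone X"
    have "frame_matrix (\<phi> b) (?\<alpha> t) = \<gamma> t" for t
      by (rule frame_matrix_eqI[OF \<phi>_iso[OF b]]) (simp add: glue_lower[OF b] M_def)
    then show ?thesis
      using \<phi>_isometry[OF b] path_\<gamma> \<gamma>_image by (intro exI[of _ "\<phi> b"]) simp
  next
    assume b: "b \<in> upper_cone X"
    then obtain x s where xs: "x \<in> topspace X" "1/2 \<le> s" "s \<le> 1" "b = susp_pt X x s"
      unfolding upper_cone_def by blast
    define w where "w = \<bar>2 * s - 1\<bar>"
    have w: "0 \<le> w" "w \<le> 1"
      using xs by (auto simp: w_def)
    have fm: "frame_matrix (\<psi> b) (?\<alpha> t) = H (t,(x,w))" if "t \<in> {0..1}" for t
    proof (rule frame_matrix_eqI[OF \<psi>_iso[OF b]])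
      have "N t b = H (t,(x,w))"
        using that xs by (simp add: N_pt w_def)
      then show "glue (M t) (N t) (\<psi> b v) = \<psi> b (H (t,(x,w)) *v v)" for v
        by (simp only: glue_upper[OF MN[OF that] b])
    qed
    have le: "w + (1 - w) * u \<le> 1" if "u \<le> 1" for u
    proof -
      have "(1 - w) * u \<le> (1 - w) * 1"
        using that w by (intro mult_left_mono) auto
      then show ?thesis
        by simp
    qed
    let ?D = "prod_topology unit_interval unit_interval"
    let ?h = "\<lambda>z. H (snd z, (x, w + (1 - w) * fst z))"
    have "continuous_map unit_interval unit_interval (\<lambda>u. w + (1 - w) * u)"
      using w le by (auto intro!: continuous_intros)
    then have "continuous_map ?D unit_interval (\<lambda>z. w + (1 - w) * fst z)"
      by (rule continuous_map_compose_pt[OF continuous_map_fst])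
    moreover have "continuous_map ?D X (\<lambda>_. x)"
      using xs by simp
    ultimately have "continuous_map ?D (top_of_set SO) ?h"
      by (intro continuous_map_compose_pt[OF _ H] continuous_map_pairedI continuous_map_snd)
    then have "continuous_on ({0..1} \<times> {0..1}) ?h" "?h \<in> {0..1} \<times> {0..1} \<rightarrow> SO"
      by (simp_all add: continuous_map_in_subtopology image_subset_iff_funcset)
    moreover have "pathstart (?h \<circ> Pair u) = mat 1 \<and> pathfinish (?h \<circ> Pair u) = - mat 1"
      if u: "u \<in> {0..1}" for u
      using ends[OF xs(1), of "w + (1 - w) * u"] u w le[of u] by (simp add: pathstart_def pathfinish_def)
    moreover have "frame_matrix (\<psi> b) (?\<alpha> 0) = mat 1" "frame_matrix (\<psi> b) (?\<alpha> 1) = - mat 1"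
      using ends[OF xs(1), of w] w by (simp_all add: fm)
    moreover have "\<forall>t\<in>{0..1}. ?h (0,t) = frame_matrix (\<psi> b) (?\<alpha> t)" "\<forall>t\<in>{0..1}. ?h (1,t) = \<gamma> t"
      using H1[OF _ xs(1)] by (simp_all add: fm)
    ultimately have "homotopic_paths SO (\<lambda>t. frame_matrix (\<psi> b) (?\<alpha> t)) \<gamma>"
      unfolding homotopic_paths
      by (intro exI[of _ ?h]) (simp add: pathstart_def pathfinish_def)
    then show ?thesis
      using \<psi>_isometry[OF b] by blast
  qed
  ultimately show ?thesis
    unfolding gamma_turnable_def gamma_turning_def frame_matrix_def by blast
qed

text \<open>A null-homotopy \<open>K\<close> of the obstruction moves the values at the two poles, while a turning must stay
  at \<open>1\<close> and \<open>-1\<close> there. Dividing \<open>K(r,[x,t])\<close> by \<open>K(r,[x0,t])\<close> for a base point \<open>x0\<close> makes it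
  trivial at the poles. At \<open>r = 0\<close> this introduces the inverse of \<open>g x0 ** \<gamma> t ** transpose (g x0)\<close>, which
  is compensated by the conjugate of \<open>\<gamma>\<close> by \<open>c r\<close>, with a path \<open>c\<close> from \<open>g x0\<close> to \<open>1\<close>.\<close>

lemma gamma_turnable_if_null_homotopic:
  assumes "homotopic_SO S (TO_map \<gamma> g) (\<lambda>_. mat 1)"
  shows "gamma_turnable S E \<gamma>"
proof (cases "topspace X = {}")
  case True
  then show ?thesis
    by (intro gamma_turnable_if_homotopy[of "\<lambda>_. mat 1"]) auto
next
  case False
  then obtain x0 where x0: "x0 \<in> topspace X"
    by blast
  obtain K where K: "continuous_map (prod_topology unit_interval S) (top_of_set SO) K"
    "\<And>p. K (0,p) = TO_map \<gamma> g p" "\<And>p. K (1,p) = mat 1"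
    using assms unfolding homotopic_with_def by blast
  have KSO: "K (r, susp_pt X x t) \<in> SO" if "r \<in> {0..1}" "x \<in> topspace X" "t \<in> {0..1}" for r x t
    using continuous_map_SO_mem[OF K(1)] that by simp
  obtain c where c: "path c" "path_image c \<subseteq> SO" "pathstart c = g x0" "pathfinish c = mat 1"
    using path_connected_SO[OF dim] g_SO[OF x0] mat_1_in_SO unfolding path_connected_def by blast
  then have cc: "continuous_map unit_interval (top_of_set SO) c" and c01: "c 0 = g x0" "c 1 = mat 1"
    by (auto simp: path_def path_image_def pathstart_def pathfinish_def)
  have cSO: "c r \<in> SO" if "r \<in> {0..1}" for r
    using continuous_map_SO_mem[OF cc] that by simp
  define H where "H = (\<lambda>z. K (snd (snd z), susp_pt X (fst (snd z)) (fst z)) **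
      transpose (K (snd (snd z), susp_pt X x0 (fst z))) **
      (c (snd (snd z)) ** \<gamma> (fst z) ** transpose (c (snd (snd z)))))"
  show ?thesis
  proof (rule gamma_turnable_if_homotopy)
    show "continuous_map (prod_topology unit_interval (prod_topology X unit_interval)) (top_of_set SO) H"
      unfolding H_def using x0
      by (intro continuous_map_SO_intros continuous_map_compose_pt[OF _ K(1)]
          continuous_map_susp_pt continuous_map_compose_pt[OF _ cc]
          continuous_map_compose_pt[OF _ continuous_map_\<gamma>]) simp_all
  next
    fix t x
    assume "t \<in> {0..1::real}" "x \<in> topspace X"
    then show "H (t,(x,0)) = g x ** \<gamma> t ** transpose (g x)"
      using x0 by (simp add: H_def K TO_map_susp_pt[OF g] c01 matrix_transpose_mul g_SO \<gamma>_SO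
          flip: matrix_mul_assoc)
    show "H (t,(x,1)) = \<gamma> t"
      by (simp add: H_def K c01)
  next
    fix x and r :: real
    assume x: "x \<in> topspace X" and r: "r \<in> {0..1}"
    then show "H (0,(x,r)) = mat 1 \<and> H (1,(x,r)) = - mat 1"
      using KSO[OF r x0, of 0] KSO[OF r x0, of 1] cSO[OF r] by (simp add: H_def)
  qed
qed

text \<open>The definition provides some frame in which the turning of the fibre is path homotopic to \<open>\<gamma>\<close>. Any
  other positive isometric frame differs from it by a rotation, and conjugation by a path from \<open>1\<close> to
  this rotation fixes the endpoints \<open>\<plusminus>1\<close>.\<close>

lemma frame_matrix_path_homotopy:
  assumes \<alpha>: "gamma_turning S E \<gamma> \<alpha>" and b: "b \<in> topspace S" and f: "oriented_fibre_isometry E b f"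
  obtains k where "continuous_map (prod_topology unit_interval unit_interval) (top_of_set SO) k"
    "\<forall>t\<in>{0..1}. k (0,t) = \<gamma> t \<and> k (1,t) = frame_matrix f (\<alpha> t)"
    "\<forall>r\<in>{0..1}. k (r,0) = mat 1 \<and> k (r,1) = - mat 1"
proof -
  obtain f0 where f0: "oriented_fibre_isometry E b f0"
    and "homotopic_paths SO (\<lambda>t. frame_matrix f0 (\<alpha> t)) \<gamma>"
    using \<alpha> b unfolding gamma_turning_def frame_matrix_def by blast
  then have "homotopic_paths SO \<gamma> (\<lambda>t. frame_matrix f0 (\<alpha> t))"
    by (simp add: homotopic_paths_sym)
  then obtain h where h: "continuous_on ({0..1} \<times> {0..1}) h" "h \<in> ({0..1} \<times> {0..1}) \<rightarrow> SO"
    "\<forall>t\<in>{0..1}. h (0,t) = \<gamma> t" "\<forall>t\<in>{0..1}. h (1,t) = frame_matrix f0 (\<alpha> t)"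
    "\<forall>r\<in>{0..1::real}. h (r,0) = mat 1 \<and> h (r,1) = - mat 1"
    unfolding homotopic_paths by (auto simp: pathstart_def pathfinish_def)
  obtain C where C: "C \<in> SO" "\<And>v. f v = f0 (C *v v)"
    using frame_change[OF orientation b f0 f] by blast
  obtain c where c: "path c" "path_image c \<subseteq> SO" "pathstart c = mat 1" "pathfinish c = C"
    using path_connected_SO[OF dim] C(1) mat_1_in_SO unfolding path_connected_def by blast
  then have cc: "continuous_map unit_interval (top_of_set SO) c" and c01: "c 0 = mat 1" "c 1 = C"
    by (auto simp: path_def path_image_def pathstart_def pathfinish_def)
  have cSO: "c r \<in> SO" if "r \<in> {0..1}" for r
    using continuous_map_SO_mem[OF cc] that by simp
  have aut: "bundle_automorphism S E (\<alpha> t)" if "t \<in> {0..1}" for t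
    using \<alpha> that by (simp add: gamma_turning_def turning_def)
  show thesis
  proof
    have "continuous_map (prod_topology unit_interval unit_interval) (top_of_set SO) h"
      using h by auto
    then show "continuous_map (prod_topology unit_interval unit_interval) (top_of_set SO)
        (\<lambda>z. transpose (c (fst z)) ** h z ** c (fst z))"
      by (intro continuous_map_SO_intros continuous_map_compose_pt[OF _ cc])
    show "\<forall>t\<in>{0..1}. transpose (c (fst (0,t))) ** h (0,t) ** c (fst (0,t)) = \<gamma> t \<and>
        transpose (c (fst (1,t))) ** h (1,t) ** c (fst (1,t)) = frame_matrix f (\<alpha> t)"
      using h frame_matrix_change[OF aut b f0[THEN oriented_fibre_isometry_iso]
          f[THEN oriented_fibre_isometry_iso] C] by (simp add: c01)
    show "\<forall>r\<in>{0..1}. transpose (c (fst (r,0))) ** h (r,0) ** c (fst (r,0)) = mat 1 \<and>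
        transpose (c (fst (r,1))) ** h (r,1) ** c (fst (r,1)) = - mat 1"
      using h cSO by simp
  qed
qed

lemma frame_matrix_gamma_turning:
  assumes "gamma_turning S E \<gamma> \<alpha>" "b \<in> topspace S" "oriented_fibre_isometry E b f"
  shows "t \<in> {0..1} \<Longrightarrow> frame_matrix f (\<alpha> t) \<in> SO"
    "frame_matrix f (\<alpha> 0) = mat 1" "frame_matrix f (\<alpha> 1) = - mat 1"
proof -
  obtain k where k: "continuous_map (prod_topology unit_interval unit_interval) (top_of_set SO) k"
    "\<forall>t\<in>{0..1}. k (0,t) = \<gamma> t \<and> k (1,t) = frame_matrix f (\<alpha> t)"
    "\<forall>r\<in>{0..1}. k (r,0) = mat 1 \<and> k (r,1) = - mat 1"
    by (rule frame_matrix_path_homotopy[OF assms])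
  show "frame_matrix f (\<alpha> t) \<in> SO" if "t \<in> {0..1}"
    using continuous_map_SO_mem[OF k(1), of "(1,t)"] k(2) that by simp
  show "frame_matrix f (\<alpha> 0) = mat 1" "frame_matrix f (\<alpha> 1) = - mat 1"
    using k(2,3) by (metis atLeastAtMost_iff order_refl zero_le_one)+
qed

text \<open>With \<open>A t b\<close> and \<open>B t b\<close> the matrices of the turning over the two cones, the obstruction is
  deformed in four stages: \<open>\<gamma>\<close> is replaced by the path over the lower apex; the base point \<open>[x,r/2]\<close>
  moves up to the equator, where conjugation by \<open>g x\<close> turns \<open>A\<close> into \<open>B\<close>; it moves on to the upper
  apex, where the path is independent of \<open>x\<close>; and that path is shrunk to its starting point.\<close>

lemma null_homotopic_if_gamma_turnable:
  assumes "gamma_turnable S E \<gamma>"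
  shows "homotopic_SO S (TO_map \<gamma> g) (\<lambda>_. mat 1)"
proof (cases "topspace X = {}")
  case True
  then show ?thesis
    by (intro homotopic_SO_empty) (simp add: topspace_suspension)
next
  case False
  then obtain x0 where x0: "x0 \<in> topspace X"
    by blast
  obtain \<alpha> where \<alpha>: "gamma_turning S E \<gamma> \<alpha>"
    using assms unfolding gamma_turnable_def by blast
  then have turning: "turning S E \<alpha>"
    by (simp add: gamma_turning_def)
  define A where "A t b = frame_matrix (\<phi> b) (\<alpha> t)" for t b
  define B where "B t b = frame_matrix (\<psi> b) (\<alpha> t)" for t b
  have low: "b \<in> topspace S" if "b \<in> lower_cone X" for b
    using that by (simp add: lower_cone_iff)
  have up: "b \<in> topspace S" if "b \<in> upper_cone X" for b
    using that by (simp add: upper_cone_iff)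
  have ASO: "t \<in> {0..1} \<Longrightarrow> A t b \<in> SO" and A0: "A 0 b = mat 1" and A1: "A 1 b = - mat 1"
    if "b \<in> lower_cone X" for t b
    unfolding A_def using frame_matrix_gamma_turning[OF \<alpha> low[OF that] \<phi>_isometry[OF that]] by simp_all
  have BSO: "t \<in> {0..1} \<Longrightarrow> B t b \<in> SO" and B0: "B 0 b = mat 1" and B1: "B 1 b = - mat 1"
    if "b \<in> upper_cone X" for t b
    unfolding B_def using frame_matrix_gamma_turning[OF \<alpha> up[OF that] \<psi>_isometry[OF that]] by simp_all
  have Ac: "continuous_map (prod_topology unit_interval (subtopology S (lower_cone X))) (top_of_set SO) (\<lambda>z. A (fst z) (snd z))"
    using continuous_map_frame_matrix[OF \<phi> turning] ASO by (auto simp: continuous_map_SO_iff A_def)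
  have Bc: "continuous_map (prod_topology unit_interval (subtopology S (upper_cone X))) (top_of_set SO) (\<lambda>z. B (fst z) (snd z))"
    using continuous_map_frame_matrix[OF \<psi> turning] BSO by (auto simp: continuous_map_SO_iff B_def)
  have lower: "susp_pt X x (r/2) \<in> lower_cone X" and upper: "susp_pt X x ((1 + r)/2) \<in> upper_cone X"
    if "x \<in> topspace X" "r \<in> {0..1}" for x r
    using that by (auto simp: lower_cone_iff upper_cone_iff)
  have AB: "g x ** A t (susp_pt X x (1/2)) ** transpose (g x) = B t (susp_pt X x (1/2))"
    if x: "x \<in> topspace X" and t: "t \<in> {0..1}" for x t
  proof -
    let ?b = "susp_pt X x (1/2)"
    have b: "?b \<in> lower_cone X" "?b \<in> upper_cone X"
      using x by (simp_all add: lower_cone_iff upper_cone_iff)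
    have "bundle_automorphism S E (\<alpha> t)"
      using turning t by (simp add: turning_def)
    then have "A t ?b = transpose (g x) ** B t ?b ** g x"
      unfolding A_def B_def
      by (rule frame_matrix_change[OF _ low[OF b(1)] \<psi>_iso[OF b(2)] \<phi>_iso[OF b(1)] g_SO[OF x] clutch[OF x]])
    then show ?thesis
      using g_SO[OF x] by (simp flip: matrix_mul_assoc)
  qed
  let ?b0 = "topspace X \<times> {0::real}" and ?b1 = "topspace X \<times> {1::real}"
  have b0: "?b0 \<in> lower_cone X" and b1: "?b1 \<in> upper_cone X"
    using lower[OF x0, of 0] upper[OF x0, of 1] by simp_all
  let ?XI = "prod_topology unit_interval (prod_topology X unit_interval)"
  have coords: "continuous_map ?XI unit_interval (\<lambda>z. snd (snd z))"
      "continuous_map ?XI X (\<lambda>z. fst (snd z))" "continuous_map ?XI unit_interval fst"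
    by (intro continuous_map_coordinates)+
  have gc: "continuous_map ?XI (top_of_set SO) (\<lambda>z. g (fst (snd z)))"
    by (rule continuous_map_compose_pt[OF coords(2) g])
  obtain k where k: "continuous_map (prod_topology unit_interval unit_interval) (top_of_set SO) k"
    "\<forall>t\<in>{0..1}. k (0,t) = \<gamma> t \<and> k (1,t) = A t ?b0"
    "\<forall>r\<in>{0..1}. k (r,0) = mat 1 \<and> k (r,1) = - mat 1"
    using frame_matrix_path_homotopy[OF \<alpha> low[OF b0] \<phi>_isometry[OF b0]] unfolding A_def by blast
  define T1 where "T1 = susp_lift (\<lambda>(x,t). g x ** A t ?b0 ** transpose (g x))"
  define T2 where "T2 = susp_lift (\<lambda>(x,t). B t (susp_pt X x (1/2)))"
  define T3 where "T3 = susp_lift (\<lambda>(x::'a,t). B t ?b1)"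
  have T1: "T1 (susp_pt X x t) = g x ** A t ?b0 ** transpose (g x)" if "x \<in> topspace X" for x t
    using susp_lift_susp_pt[of X "\<lambda>(x,t). g x ** A t ?b0 ** transpose (g x)" x t] that g_SO A0[OF b0] A1[OF b0]
    by (simp add: T1_def constant_on_ends_def)
  have mid: "susp_pt X x (1/2) \<in> upper_cone X" if "x \<in> topspace X" for x
    using upper[OF that, of 0] by simp
  have T2: "T2 (susp_pt X x t) = B t (susp_pt X x (1/2))" if "x \<in> topspace X" for x t
    using susp_lift_susp_pt[of X "\<lambda>(x,t). B t (susp_pt X x (1/2))" x t] that B0[OF mid] B1[OF mid]
    by (simp add: T2_def constant_on_ends_def)
  have T3: "T3 (susp_pt X x t) = B t ?b1" if "x \<in> topspace X" for x t
    using susp_lift_susp_pt[of X "\<lambda>(x,t). B t ?b1" x t] that by (simp add: T3_def constant_on_ends_def)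
  note [trans] = homotopic_with_trans
  have "homotopic_SO S (TO_map \<gamma> g) T1"
  proof (rule homotopic_suspensionI)
    show "continuous_map ?XI (top_of_set SO)
        (\<lambda>z. g (fst (snd z)) ** k (fst z, snd (snd z)) ** transpose (g (fst (snd z))))"
      by (intro continuous_map_SO_mult continuous_map_SO_transpose gc
          continuous_map_compose_pt[OF _ k(1)] continuous_map_pairedI coords)
    show "constant_on_ends X (\<lambda>q. g (fst (snd (r,q))) ** k (fst (r,q), snd (snd (r,q))) **
        transpose (g (fst (snd (r,q)))))" if "r \<in> {0..1}" for r
      using k(3) that g_SO by (simp add: constant_on_ends_def)
  qed (use k(2) T1 TO_map_susp_pt[OF g] in simp_all)
  also have "homotopic_SO S T1 T2"
  proof (rule homotopic_suspensionI)
    have "continuous_map unit_interval unit_interval (\<lambda>r. r / 2)"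
      by (auto intro!: continuous_intros)
    then have "continuous_map ?XI S (\<lambda>z. susp_pt X (fst (snd z)) (fst z / 2))"
      by (intro continuous_map_susp_pt coords continuous_map_compose_pt[OF coords(3)])
    then have "continuous_map ?XI (subtopology S (lower_cone X)) (\<lambda>z. susp_pt X (fst (snd z)) (fst z / 2))"
      using lower by (auto simp: continuous_map_in_subtopology)
    from continuous_map_compose_pt[OF continuous_map_pairedI[OF coords(1) this] Ac]
    show "continuous_map ?XI (top_of_set SO) (\<lambda>z. g (fst (snd z)) **
        A (snd (snd z)) (susp_pt X (fst (snd z)) (fst z / 2)) ** transpose (g (fst (snd z))))"
      by (intro continuous_map_SO_mult continuous_map_SO_transpose gc) simp
    show "constant_on_ends X (\<lambda>q. g (fst (snd (r,q))) ** A (snd (snd (r,q))) (susp_pt X (fst (snd (r,q))) (fst (r,q) / 2)) **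
        transpose (g (fst (snd (r,q)))))" if "r \<in> {0..1}" for r
      using that g_SO A0[OF lower] A1[OF lower] by (simp add: constant_on_ends_def)
  qed (use T1 T2 AB in simp_all)
  also have "homotopic_SO S T2 T3"
  proof (rule homotopic_suspensionI)
    have "continuous_map unit_interval unit_interval (\<lambda>r. (1 + r) / 2)"
      by (auto intro!: continuous_intros)
    then have "continuous_map ?XI S (\<lambda>z. susp_pt X (fst (snd z)) ((1 + fst z) / 2))"
      by (intro continuous_map_susp_pt coords continuous_map_compose_pt[OF coords(3)])
    then have "continuous_map ?XI (subtopology S (upper_cone X)) (\<lambda>z. susp_pt X (fst (snd z)) ((1 + fst z) / 2))"
      using upper by (auto simp: continuous_map_in_subtopology)
    from continuous_map_compose_pt[OF continuous_map_pairedI[OF coords(1) this] Bc]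
    show "continuous_map ?XI (top_of_set SO) (\<lambda>z. B (snd (snd z)) (susp_pt X (fst (snd z)) ((1 + fst z) / 2)))"
      by simp
    show "constant_on_ends X (\<lambda>q. B (snd (snd (r,q))) (susp_pt X (fst (snd (r,q))) ((1 + fst (r,q)) / 2)))"
      if "r \<in> {0..1}" for r
      using that B0[OF upper] B1[OF upper] by (simp add: constant_on_ends_def)
  qed (use T2 T3 in simp_all)
  also have "homotopic_SO S T3 (\<lambda>_. mat 1)"
  proof -
    have "continuous_map unit_interval (prod_topology unit_interval (subtopology S (upper_cone X))) (\<lambda>t. (t, ?b1))"
      using b1 up[OF b1] by (intro continuous_map_pairedI) auto
    from continuous_map_compose_pt[OF this Bc]
    have "continuous_map unit_interval (top_of_set SO) (\<lambda>t. B t ?b1)"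
      by simp
    from homotopic_path_const[OF this] show ?thesis
      by (simp add: T3_def B0[OF b1])
  qed
  finally show ?thesis .
qed

lemma gamma_turnable_iff_TO_trivial:
  "gamma_turnable S E \<gamma> \<longleftrightarrow> TO X \<gamma> (hclass X g) = \<one>\<^bsub>homotopy_group_SO S\<^esub>"
  using gamma_turnable_if_null_homotopic null_homotopic_if_gamma_turnable
  by (auto simp: TO_hclass[OF g] one_homotopy_group_SO hclass_eq_iff[OF continuous_map_TO_map[OF g]])

end

theorem proposition1p6:
  fixes X :: "'a topology" and \<gamma> :: "real \<Rightarrow> real^'n^'n" and k :: nat
  assumes "k > 1" and "CARD('n) = 2 * k"
    and "path \<gamma>" and "path_image \<gamma> \<subseteq> SO" and "pathstart \<gamma> = mat 1" and "pathfinish \<gamma> = - mat 1"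
    and "cw_complex X"
  shows "(\<forall>(E :: (('a \<times> real) set, 'e, 'n) vbundle) g.
            oriented_euclidean_bundle (suspension X) E \<and> clutching_function X E g \<longrightarrow>
            (gamma_turnable (suspension X) E \<gamma> \<longleftrightarrow>
             TO X \<gamma> (hclass X g) = \<one>\<^bsub>homotopy_group_SO (suspension X)\<^esub>)) \<and>
         (\<forall>Y :: 'b topology. X homeomorphic_space suspension Y \<longrightarrow>
            comm_group (homotopy_group_SO X :: ('a \<Rightarrow> real^'n^'n) set monoid) \<and>
            comm_group (homotopy_group_SO (suspension X) :: (('a \<times> real) set \<Rightarrow> real^'n^'n) set monoid) \<and>
            TO X \<gamma> \<in> hom (homotopy_group_SO X) (homotopy_group_SO (suspension X)))"
proof -
  have n: "2 \<le> CARD('n)"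
    using assms(1,2) by simp
  interpret turning_path \<gamma>
    by unfold_locales (rule assms)+
  have "gamma_turnable (suspension X) E \<gamma> \<longleftrightarrow>
      TO X \<gamma> (hclass X g) = \<one>\<^bsub>homotopy_group_SO (suspension X)\<^esub>"
    if E: "oriented_euclidean_bundle (suspension X) E" and g: "clutching_function X E g"
    for E :: "(('a \<times> real) set, 'e, 'n) vbundle" and g
  proof -
    obtain \<phi> \<psi> where "clutched_bundle X E g \<phi> \<psi>"
      using E g unfolding clutching_function_def clutched_bundle_def by blast
    then interpret clutched_bundle_turning_path X E g \<phi> \<psi> \<gamma>
      by (intro clutched_bundle_turning_path.intro turning_path_axioms
          clutched_bundle_turning_path_axioms.intro n)
    show ?thesis
      by (rule gamma_turnable_iff_TO_trivial)
  qed
  moreover have "comm_group (homotopy_group_SO X :: ('a \<Rightarrow> real^'n^'n) set monoid) \<and>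
      comm_group (homotopy_group_SO (suspension X) :: (('a \<times> real) set \<Rightarrow> real^'n^'n) set monoid) \<and>
      TO X \<gamma> \<in> hom (homotopy_group_SO X) (homotopy_group_SO (suspension X))"
    if Y: "X homeomorphic_space suspension Y" for Y :: "'b topology"
    using comm_group_homotopy_group_SO[OF n Y] TO_hom[OF n Y]
      comm_group_homotopy_group_SO[OF n homeomorphic_space_refl] by blast
  ultimately show ?thesis
    by blast
qed

end
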